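(* There exists an absolute constant $\varepsilon>0$ such that the following holds. Let $G$ be an arbitrary Abelian group and let $d\in\mathbb{N}$. For all natural numbers $n$ and $k$ with $d\le k\le n-d$ and $d\le t^{\varepsilon}$, where $t=\min\{k,n-k\}$: for every polynomial $P$ of degree at most $d$ with coefficients in $G$ which does not vanish identically on $\{0,1\}^n_k$, \[ \Pr_{\mathbf{x}\sim\{0,1\}^n_k}[P(\mathbf{x})\neq 0]\;\ge\;\Big(\frac{t}{n}\Big)^{d}\cdot\Big(1-\frac{1}{t^{\varepsilon}}\Big), \] where $\mathbf{x}$ is uniform on $\{0,1\}^n_k$.
   Context: $\{0,1\}^n_k$ denotes the set of $\mathbf{x}\in\{0,1\}^n$ of Hamming weight exactly $k$ (the Boolean slice). For an Abelian group $(G,+)$, a (multilinear) polynomial of degree at most $d$ over $G$ is an expression $P(\mathbf{x})=\sum_{S\subseteq[n],|S|\le d}a_S\prod_{i\in S}x_i$ with $a_S\in G$; it is evaluated at $\mathbf{x}\in\{0,1\}^n$ as the sum of those $a_S$ with $x_i=1$ for all $i\in S$. "Does not vanish on $\{0,1\}^n_k$" means $P(\mathbf{x})\ne0$ for at least one $\mathbf{x}\in\{0,1\}^n_k$. *)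

theory Defs
  imports "HOL-Algebra.Group" "HOL-Algebra.FiniteProduct" "HOL-Probability.Probability_Mass_Function"
begin

text \<open>Coordinates are indexed by \<open>{..<n}\<close>.\<close>

definition slice :: "nat \<Rightarrow> nat \<Rightarrow> (nat \<Rightarrow> nat) set" where
  "slice n k = {x \<in> {..<n} \<rightarrow>\<^sub>E {0, 1}. (\<Sum>i<n. x i) = k}"

definition monomials :: "nat \<Rightarrow> nat \<Rightarrow> nat set set" where
  "monomials n d = {S. S \<subseteq> {..<n} \<and> card S \<le> d}"

text \<open>
  Abelian groups are commutative groups of HOL-Algebra, which are written multiplicatively:
  the group sum is \<open>finprod\<close> and the zero element is \<open>\<one>\<close>. A polynomial is its coefficient
  family, so a polynomial of degree at most \<open>d\<close> over \<open>G\<close> is an element of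
  \<open>monomials n d \<rightarrow> carrier G\<close>. Coefficients outside \<open>monomials n d\<close> are never used.
\<close>

definition poly_eval :: "'g monoid \<Rightarrow> nat \<Rightarrow> nat \<Rightarrow> (nat set \<Rightarrow> 'g) \<Rightarrow> (nat \<Rightarrow> nat) \<Rightarrow> 'g" where
  "poly_eval G n d a x = finprod G a {S \<in> monomials n d. \<forall>i\<in>S. x i = 1}"

definition slice_distance_bound :: "real \<Rightarrow> 'g monoid \<Rightarrow> bool" where
  "slice_distance_bound \<epsilon> G \<longleftrightarrow>
     (\<forall>d n k. \<forall>t. t = min k (n - k) \<longrightarrow> d \<le> k \<longrightarrow> k + d \<le> n \<longrightarrow> real d \<le> real t powr \<epsilon> \<longrightarrow>
       (\<forall>P \<in> monomials n d \<rightarrow> carrier G.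
          (\<exists>x\<in>slice n k. poly_eval G n d P x \<noteq> \<one>\<^bsub>G\<^esub>) \<longrightarrow>
          measure_pmf.prob (pmf_of_set (slice n k)) {x. poly_eval G n d P x \<noteq> \<one>\<^bsub>G\<^esub>}
            \<ge> (real t / real n) ^ d * (1 - 1 / real t powr \<epsilon>)))"

text \<open>
  HOL cannot quantify over types inside a formula, so an existential \<open>\<epsilon>\<close> in front of
  ``every group with carrier in \<open>'g\<close>'' could depend on the type \<open>'g\<close>. To have an absolute
  constant, \<open>\<epsilon>\<close> is a closed term of type \<^typ>\<open>real\<close>: some positive real that works for all
  groups with carrier in \<^typ>\<open>nat\<close>. That it is positive, and that it works for groups over
  every other type, does not follow from the definition alone. Nothing is lost by
  looking at \<^typ>\<open>nat\<close> here: the coefficients of one polynomial generate a countable subgroup.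
\<close>

definition abs_eps :: real where
  "abs_eps = (SOME \<epsilon>. \<epsilon> > 0 \<and> (\<forall>G :: nat monoid. comm_group G \<longrightarrow> slice_distance_bound \<epsilon> G))"

end

theory Submission imports Defs "HOL-Algebra.Generated_Groups" begin

text \<open>
  View a function on the slice as a function \<open>f\<close> on the \<open>k\<close>-subsets of an \<open>n\<close>-set and call its degree
  at most \<open>d\<close> if all \<open>d + 1\<close> fold differences along disjoint swaps \<open>a \<leftrightarrow> b\<close> vanish. For \<open>2k \<le> n\<close>, a
  nonzero \<open>f\<close> of degree at most \<open>d\<close> is nonzero with probability at least \<open>(k/n)\<^sup>d (1 - 8d\<^sup>2/k)\<close>, by
  induction on \<open>n\<close>. If \<open>f\<close> is not constant, some coordinate \<open>i\<close> has the property that swapping \<open>i\<close> and \<open>j\<close>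
  matters for at least half of all \<open>j\<close>. If \<open>f\<close> vanishes whenever \<open>x\<^sub>i = 0\<close>, restricting to \<open>x\<^sub>i = 1\<close>
  costs a factor \<open>k/n\<close> and lowers the degree. Otherwise expose \<open>x\<^sub>i\<close>: with probability \<open>1 - 2k/n\<close> it is
  \<open>0\<close>, which keeps \<open>f\<close> nonzero and increases \<open>k/n\<close>; else it is paired with a random \<open>j\<close> of opposite
  value. For at least half of the \<open>j\<close> the difference of the two restrictions is nonzero of smaller degree;
  for all but \<open>d\<close> of the other \<open>j\<close> both restrictions are equal and nonzero. As the degree drops with
  constant probability in each pairing step, the losses from the exceptional \<open>j\<close> sum up to \<open>O(d\<^sup>2/k)\<close>.
  The case \<open>2k > n\<close> follows by complementation, and groups over an arbitrary type reduce to groups over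
  \<open>nat\<close> because the coefficients of one polynomial generate a countable subgroup.
\<close>

subsection \<open>Recursive inequalities for the bound\<close>

text \<open>The lower bound carried through the induction. It is nonpositive for
  \<open>0 < k \<le> 8 * d\<^sup>2\<close>, so only large \<open>k\<close> needs an argument, and it
  equals 1 for \<open>d = 0\<close>, also when \<open>k = 0\<close>.\<close>

definition phi :: "nat \<Rightarrow> nat \<Rightarrow> nat \<Rightarrow> real" where
  "phi n k d = (real k / real n) ^ d * (1 - 8 * (real d)\<^sup>2 / real k)"

lemma phi_le_one: "k \<le> n \<Longrightarrow> phi n k d \<le> 1"
proof -
  assume "k \<le> n"
  then have r: "0 \<le> (real k / real n) ^ d" "(real k / real n) ^ d \<le> 1"
    by (simp, intro power_le_one) (simp_all add: divide_simps)
  have "phi n k d \<le> (real k / real n) ^ d * 1"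
    unfolding phi_def using r by (intro mult_left_mono) auto
  then show ?thesis using r by simp
qed

text \<open>Bernoulli's inequality gives \<open>(1 - 1/k)^d \<ge> 1 - d/k\<close>, and k/n times (1
  - 1/k) is (k-1)/n, which only grows when n is replaced by the smaller m. This is the price of
  fixing one element to lie in the set.\<close>

lemma shifted_ratio_power_ge:
  assumes "0 < k" "k \<le> n" "m < n" "0 < m"
  shows "(real k / real n) ^ d * (1 - real d / real k) \<le> (real (k - 1) / real m) ^ d"
proof -
  have "1 + real d * (- 1 / real k) \<le> (1 + - 1 / real k) ^ d"
    using assms by (intro Bernoulli_inequality) simp
  then have "(real k / real n) ^ d * (1 - real d / real k) \<le> (real k / real n) ^ d * (1 - 1 / real k) ^ d"
    by (intro mult_left_mono) auto
  also have "\<dots> = (real (k - 1) / real n) ^ d"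
  proof -
    have "(real k / real n) * (1 - 1 / real k) = real (k - 1) / real n"
      using assms by (simp add: of_nat_diff right_diff_distrib diff_divide_distrib)
    then show ?thesis by (metis power_mult_distrib)
  qed
  also have "\<dots> \<le> (real (k - 1) / real m) ^ d"
    using assms by (intro power_mono divide_left_mono) auto
  finally show ?thesis .
qed

text \<open>For \<open>x \<le> l\<close>, x/l is at most (x+1)/(l+1): moving the denominator from
  \<open>l\<close> back to \<open>k = Suc l\<close> costs 1 in the numerator.\<close>

lemma error_term_shift:
  assumes "8 * (real e)\<^sup>2 \<le> real l" "0 < l"
  shows "8 * (real e)\<^sup>2 / real l \<le> (8 * (real e)\<^sup>2 + 1) / real (Suc l)"
  using assms by (simp add: field_simps)

text \<open>This serves the case where the function vanishes for \<open>x\<^sub>i = 0\<close>. One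
  factor k/n is split off, and passing from d = e+1 to e frees 16e + 8 in the numerator of the
  error, more than the e from Bernoulli and the 1 from the shifted denominator.\<close>

lemma phi_factor_step:
  assumes "8 * (Suc e)\<^sup>2 < Suc l" "2 * Suc l \<le> n"
  shows "phi n (Suc l) (Suc e) \<le> (real (Suc l) / real n) * phi (n - 1) l e"
proof -
  define k where "k = real (Suc l)"
  have l: "8 * (real (Suc e))\<^sup>2 \<le> real l"
    using assms(1) by (metis less_Suc_eq_le of_nat_le_iff of_nat_mult of_nat_numeral of_nat_power)
  have k: "k > 0" by (simp add: k_def)
  have le: "8 * (real e)\<^sup>2 \<le> real l"
    using l power_mono[of "real e" "real (Suc e)" 2] by linarith
  have l0: "0 < l" using assms by (auto intro: gr0I)
  have err: "8 * (real e)\<^sup>2 / real l \<le> (8 * (real e)\<^sup>2 + 1) / k"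
    using error_term_shift[OF le l0] by (simp add: k_def)
  have err1: "8 * (real e)\<^sup>2 / real l \<le> 1" using le l0 by simp
  have "1 - 8 * (real (Suc e))\<^sup>2 / k \<le> 1 - real e / k - (8 * (real e)\<^sup>2 + 1) / k"
    using k by (simp add: field_simps power2_eq_square)
  also have "\<dots> \<le> 1 - real e / k - 8 * (real e)\<^sup>2 / real l" using err by simp
  also have "\<dots> \<le> (1 - real e / k) * (1 - 8 * (real e)\<^sup>2 / real l)"
  proof -
    have "0 \<le> (real e / k) * (8 * (real e)\<^sup>2 / real l)" using k by simp
    then show ?thesis by (simp only: left_diff_distrib right_diff_distrib)
  qed
  finally have 1: "1 - 8 * (real (Suc e))\<^sup>2 / k \<le> (1 - real e / k) * (1 - 8 * (real e)\<^sup>2 / real l)" .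
  have "phi n (Suc l) (Suc e) = (k / real n) ^ Suc e * (1 - 8 * (real (Suc e))\<^sup>2 / k)"
    by (simp add: phi_def k_def)
  also have "\<dots> \<le> (k / real n) ^ Suc e * ((1 - real e / k) * (1 - 8 * (real e)\<^sup>2 / real l))"
    using k by (intro mult_left_mono 1) auto
  also have "\<dots> = (k / real n) * (((k / real n) ^ e * (1 - real e / k)) * (1 - 8 * (real e)\<^sup>2 / real l))"
    by simp
  also have "\<dots> \<le> (k / real n) * ((real l / real (n - 1)) ^ e * (1 - 8 * (real e)\<^sup>2 / real l))"
    using shifted_ratio_power_ge[of "Suc l" n "n - 1" e] assms k err1 l0
    by (intro mult_left_mono mult_right_mono) (auto simp: k_def)
  finally show ?thesis by (simp add: phi_def k_def)
qed

text \<open>The last claim mirrors the pairing step: half of the \<open>j\<close> yield the bound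
  for degree e, the other half twice the bound for d = e+1, and d exceptional \<open>j\<close> out
  of n-1 lose twice that bound each. A degree drop at least doubles the bound because it saves a
  factor \<open>q \<le> 1/2\<close>.\<close>

lemma
  assumes "8 * (Suc e)\<^sup>2 < Suc l" "2 * Suc l \<le> n"
  shows phi_nonneg: "0 \<le> phi (n - 2) l (Suc e)"
    and phi_degree_drop: "2 * phi (n - 2) l (Suc e) \<le> phi (n - 2) l e"
    and phi_pair_step: "phi n (Suc l) (Suc e) \<le>
      (1 - 2 * (real (Suc l) / real n)) * phi (n - 1) (Suc l) (Suc e) +
      (real (Suc l) / real n) * (phi (n - 2) l e / 2 + phi (n - 2) l (Suc e)
         - 2 * real (Suc e) * phi (n - 2) l (Suc e) / real (n - 1))"
proof -
  define k d p q where "k = real (Suc l)" and "d = real (Suc e)"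
    and "p = k / real n" and "q = real l / real (n - 2)"
  define \<epsilon> \<epsilon>1 \<epsilon>2 where "\<epsilon> = 8 * d\<^sup>2 / k" and "\<epsilon>1 = 8 * d\<^sup>2 / real l"
    and "\<epsilon>2 = 8 * (real e)\<^sup>2 / real l"
  have l: "8 * d\<^sup>2 \<le> real l" unfolding d_def
    using assms(1) by (metis less_Suc_eq_le of_nat_le_iff of_nat_mult of_nat_numeral of_nat_power)
  have d: "d \<ge> 1" and k: "k > 0" and ed: "real e = d - 1" by (auto simp: k_def d_def)
  have le: "8 * (real e)\<^sup>2 \<le> real l"
    using l power_mono[of "real e" d 2] unfolding d_def by linarith
  have l0: "0 < l" using assms by (auto intro: gr0I)
  have \<epsilon>1: "\<epsilon>1 \<le> (8 * d\<^sup>2 + 1) / k" "\<epsilon>1 \<le> 1"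
    using error_term_shift[of "Suc e" l] l l0 by (simp_all add: \<epsilon>1_def k_def d_def)
  have \<epsilon>2: "\<epsilon>2 \<le> (8 * (real e)\<^sup>2 + 1) / k" "\<epsilon>2 \<le> \<epsilon>1" "0 \<le> \<epsilon>2"
    using error_term_shift[of e l] le l0 d power_mono[of "real e" d 2]
    by (auto simp: \<epsilon>2_def \<epsilon>1_def k_def d_def divide_right_mono)
  have q: "0 \<le> q" "q \<le> 1 / 2"
    using assms(2) l0 divide_le_eq[of "real l" "real (n - 2)" "1/2"] by (auto simp: q_def)
  have p: "0 < p" "p \<le> 1 / 2" using assms by (auto simp: p_def k_def field_simps)
  have phis: "phi (n - 2) l (Suc e) = q ^ Suc e * (1 - \<epsilon>1)" "phi (n - 2) l e = q ^ e * (1 - \<epsilon>2)"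
    by (simp_all add: phi_def q_def \<epsilon>1_def \<epsilon>2_def d_def)
  show nonneg: "0 \<le> phi (n - 2) l (Suc e)" using q \<epsilon>1 by (simp add: phis)
  have qe: "2 * q ^ Suc e \<le> q ^ e" using q mult_right_mono[of q "1/2" "q ^ e"] by simp
  have drop: "2 * q ^ Suc e * (1 - \<epsilon>2) \<le> phi (n - 2) l e"
    unfolding phis using qe \<epsilon>1 \<epsilon>2 by (intro mult_right_mono) auto
  have "2 * phi (n - 2) l (Suc e) \<le> 2 * q ^ Suc e * (1 - \<epsilon>2)"
    unfolding phis using q \<epsilon>2 by (simp add: mult_left_mono)
  with drop show "2 * phi (n - 2) l (Suc e) \<le> phi (n - 2) l e" by linarith

  \<comment> \<open>Here the constant 8 is used: 8(d-1)^2 + 8d^2 lies 16d - 8 below 16d^2. This gap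
    covers two denominator shifts (2 in total), Bernoulli (2d) and the exceptional \<open>j\<close>
    (2d), as \<open>d \<ge> 1\<close>.\<close>
  have key: "\<epsilon>2 + \<epsilon>1 + 4 * d / k \<le> 2 * \<epsilon>"
  proof -
    have "\<epsilon>2 + \<epsilon>1 + 4 * d / k \<le> (8 * (real e)\<^sup>2 + 1) / k + (8 * d\<^sup>2 + 1) / k + 4 * d / k"
      using \<epsilon>1 \<epsilon>2 by simp
    also have "\<dots> = (8 * (d - 1)\<^sup>2 + 1 + (8 * d\<^sup>2 + 1) + 4 * d) / k"
      by (simp add: ed add_divide_distrib)
    also have "\<dots> \<le> (16 * d\<^sup>2) / k"
      using k d by (intro divide_right_mono) (auto simp: power2_eq_square algebra_simps)
    finally show ?thesis by (simp add: \<epsilon>_def)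
  qed
  have \<epsilon>: "\<epsilon> \<le> 1" using l k by (simp add: \<epsilon>_def k_def)
  \<comment> \<open>\<open>y\<close> collects all losses except Bernoulli's, which enters below as
    the factor 1 - d/k on 2 - y; as \<open>y \<ge> 0\<close>, that factor costs at most
    2d/k.\<close>
  define y where "y = \<epsilon>2 + \<epsilon>1 + 2 * d / k"
  have y: "y \<le> 2" "0 \<le> y" "y + 2 * d / k \<le> 2 * \<epsilon>"
  proof -
    have "0 \<le> 2 * d / k" "4 * d / k = 2 * d / k + 2 * d / k" using d k by simp_all
    then show "y \<le> 2" "0 \<le> y" "y + 2 * d / k \<le> 2 * \<epsilon>"
      using key \<epsilon> \<epsilon>2 unfolding y_def by linarith+
  qed
  have dn: "2 * d / real (n - 1) \<le> 2 * d / k"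
    using assms d k by (intro divide_left_mono) (auto simp: k_def)
  have pq: "p ^ Suc e * (1 - d / k) \<le> q ^ Suc e"
    using shifted_ratio_power_ge[of "Suc l" n "n - 2" "Suc e"] assms l0
    by (simp add: p_def q_def k_def d_def)
  have "2 * p ^ Suc e * (1 - \<epsilon>) \<le> p ^ Suc e * ((1 - d / k) * (2 - y))"
  proof -
    have "2 * (1 - \<epsilon>) \<le> 2 - y - 2 * (d / k)" using y by simp
    also have "\<dots> \<le> (1 - d / k) * (2 - y)" using y d k by (simp add: algebra_simps)
    finally have "p ^ Suc e * (2 * (1 - \<epsilon>)) \<le> p ^ Suc e * ((1 - d / k) * (2 - y))"
      using p by (intro mult_left_mono) auto
    then show ?thesis by (simp only: mult_ac)
  qed
  also have "\<dots> \<le> q ^ Suc e * (2 - y)"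
    using mult_right_mono[OF pq, of "2 - y"] y by (simp add: mult.assoc)
  also have "\<dots> = q ^ Suc e * (1 - \<epsilon>2) + q ^ Suc e * (1 - \<epsilon>1) - q ^ Suc e * (2 * d / k)"
    by (simp add: y_def algebra_simps)
  also have "\<dots> \<le> phi (n - 2) l e / 2 + phi (n - 2) l (Suc e) - phi (n - 2) l (Suc e) * (2 * d / real (n - 1))"
  proof -
    have "phi (n - 2) l (Suc e) * (2 * d / real (n - 1)) \<le> q ^ Suc e * (2 * d / k)"
    proof (rule mult_mono[OF _ dn])
      show "phi (n - 2) l (Suc e) \<le> q ^ Suc e"
        unfolding phis using q \<epsilon>1 \<epsilon>2 by (intro mult_left_le) auto
    qed (use q d in auto)
    then show ?thesis using drop by (simp add: phis(1))
  qed
  finally have br: "2 * p ^ Suc e * (1 - \<epsilon>) \<le>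
    phi (n - 2) l e / 2 + phi (n - 2) l (Suc e) - phi (n - 2) l (Suc e) * (2 * d / real (n - 1))" .
  \<comment> \<open>Fixing \<open>x\<^sub>i = 0\<close> shrinks n and keeps k, so the ratio grows
    while the error term stays the same.\<close>
  have "p ^ Suc e * (1 - \<epsilon>) \<le> (k / real (n - 1)) ^ Suc e * (1 - \<epsilon>)"
    using assms \<epsilon> k unfolding p_def
    by (intro mult_right_mono power_mono divide_left_mono) (auto simp: k_def)
  then have unm: "p ^ Suc e * (1 - \<epsilon>) \<le> phi (n - 1) (Suc l) (Suc e)"
    by (simp add: phi_def k_def \<epsilon>_def d_def)
  have "phi n (Suc l) (Suc e) = (1 - 2 * p) * (p ^ Suc e * (1 - \<epsilon>)) + p * (2 * p ^ Suc e * (1 - \<epsilon>))"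
  proof -
    have "phi n (Suc l) (Suc e) = p ^ Suc e * (1 - \<epsilon>)"
      unfolding phi_def p_def k_def \<epsilon>_def d_def ..
    moreover have "a * b = (1 - 2 * p) * (a * b) + p * (2 * a * b)" for a b
      by (simp add: algebra_simps)
    ultimately show ?thesis by metis
  qed
  also have "\<dots> \<le> (1 - 2 * p) * phi (n - 1) (Suc l) (Suc e) + p *
      (phi (n - 2) l e / 2 + phi (n - 2) l (Suc e) - phi (n - 2) l (Suc e) * (2 * d / real (n - 1)))"
    using p by (intro add_mono mult_left_mono unm br) auto
  finally show "phi n (Suc l) (Suc e) \<le>
      (1 - 2 * (real (Suc l) / real n)) * phi (n - 1) (Suc l) (Suc e) +
      (real (Suc l) / real n) * (phi (n - 2) l e / 2 + phi (n - 2) l (Suc e)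
         - 2 * real (Suc e) * phi (n - 2) l (Suc e) / real (n - 1))"
    by (simp add: p_def k_def d_def mult_ac)
qed

subsection \<open>Degree on slices\<close>

lemma Diff_right_commute: "A - B - C = A - C - (B :: 'a set)"
  by blast

context comm_group
begin

text \<open>For \<open>X\<close> avoiding \<open>a\<close> and \<open>b\<close> this is the
  difference, in multiplicative notation, of two points exchanged by the transposition of
  \<open>a\<close> and \<open>b\<close>. It is regarded as a function one level lower, on the ground
  set without \<open>a\<close> and \<open>b\<close>.\<close>

definition swap_diff :: "'v \<Rightarrow> 'v \<Rightarrow> ('v set \<Rightarrow> 'a) \<Rightarrow> 'v set \<Rightarrow> 'a" where
  "swap_diff a b f X = f (insert a X) \<otimes> inv (f (insert b X))"

definition supp :: "'v set \<Rightarrow> nat \<Rightarrow> ('v set \<Rightarrow> 'a) \<Rightarrow> 'v set set" where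
  "supp V k f = {X. X \<subseteq> V \<and> card X = k \<and> f X \<noteq> \<one>}"

definition dens :: "'v set \<Rightarrow> nat \<Rightarrow> ('v set \<Rightarrow> 'a) \<Rightarrow> real" where
  "dens V k f = card (supp V k f) / (card V choose k)"

text \<open>Degree less than \<open>m\<close>; this makes sense without a polynomial, and \<open>m = 0\<close> means that \<open>f\<close> vanishes
  on the \<open>k\<close>-subsets of \<open>V\<close>. For \<open>k = 0 < m\<close> there are no swaps and the condition is void.\<close>

primrec deg_below :: "nat \<Rightarrow> 'v set \<Rightarrow> nat \<Rightarrow> ('v set \<Rightarrow> 'a) \<Rightarrow> bool" where
  "deg_below 0 V k f \<longleftrightarrow> supp V k f = {}"
| "deg_below (Suc m) V k f \<longleftrightarrow>
     (\<forall>l a b. k = Suc l \<longrightarrow> a \<in> V \<longrightarrow> b \<in> V \<longrightarrow> a \<noteq> b \<longrightarrow>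
        deg_below m (V - {a, b}) l (swap_diff a b f))"

lemma deg_belowD:
  "\<lbrakk>deg_below (Suc m) V (Suc l) f; a \<in> V; b \<in> V; a \<noteq> b\<rbrakk> \<Longrightarrow>
    deg_below m (V - {a, b}) l (swap_diff a b f)"
  by simp

section \<open>Stability of the degree under restriction and complement\<close>

lemma swap_diff_closed [simp]:
  "(\<And>X. f X \<in> carrier G) \<Longrightarrow> swap_diff a b f X \<in> carrier G"
  by (simp add: swap_diff_def)

lemma swap_diff_eq_one_iff:
  "(\<And>X. f X \<in> carrier G) \<Longrightarrow> swap_diff a b f X = \<one> \<longleftrightarrow> f (insert a X) = f (insert b X)"
  unfolding swap_diff_def by (metis inv_closed inv_equality inv_inv r_inv)

lemma swap_diff_insert: "swap_diff a b (\<lambda>X. f (insert i X)) = (\<lambda>X. swap_diff a b f (insert i X))"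
  by (simp add: swap_diff_def[abs_def] insert_commute)

lemma finite_supp [simp]: "finite V \<Longrightarrow> finite (supp V k f)"
  by (rule finite_subset[of _ "Pow V"]) (auto simp: supp_def)

lemma supp_cong:
  "(\<And>X. X \<subseteq> V \<Longrightarrow> card X = k \<Longrightarrow> f X = g X) \<Longrightarrow> supp V k f = supp V k g"
  by (auto simp: supp_def)

lemma deg_below_cong:
  assumes "\<And>X. X \<subseteq> V \<Longrightarrow> card X = k \<Longrightarrow> f X = g X" "finite V"
  shows "deg_below m V k f = deg_below m V k g"
  using assms
proof (induction m arbitrary: V k f g)
  case 0
  then show ?case using supp_cong[of V k f g] by simp
next
  case (Suc m)
  have "deg_below m (V - {a, b}) l (swap_diff a b f) = deg_below m (V - {a, b}) l (swap_diff a b g)"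
    if "k = Suc l" "a \<in> V" "b \<in> V" "a \<noteq> b" for l a b
  proof (rule Suc.IH)
    fix X assume X: "X \<subseteq> V - {a, b}" "card X = l"
    then have "finite X" using Suc.prems(2) finite_subset by blast
    then have "card (insert a X) = k" "card (insert b X) = k" using X that
      by (auto simp: card_insert_if)
    then show "swap_diff a b f X = swap_diff a b g X"
      unfolding swap_diff_def using X that
      by (subst (1 2) Suc.prems(1)) auto
  qed (use Suc.prems in auto)
  then show ?case unfolding deg_below.simps by blast
qed

lemma deg_below_mono:
  "deg_below m V k f \<Longrightarrow> W \<subseteq> V \<Longrightarrow> deg_below m W k f"
proof (induction m arbitrary: V W k f)
  case 0
  then show ?case by (auto simp: supp_def)
next
  case (Suc m)
  show ?case unfolding deg_below.simps
  proof (intro allI impI)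
    fix l a b assume *: "k = Suc l" "a \<in> W" "b \<in> W" "a \<noteq> b"
    have "deg_below m (V - {a, b}) l (swap_diff a b f)"
      using Suc.prems * by (intro deg_belowD) auto
    then show "deg_below m (W - {a, b}) l (swap_diff a b f)"
      by (rule Suc.IH) (use Suc.prems in blast)
  qed
qed

text \<open>Swaps of elements other than \<open>i\<close> commute with inserting \<open>i\<close>,
  so fixing \<open>x\<^sub>i = 1\<close> does not raise the degree.\<close>

lemma deg_below_insert:
  assumes "deg_below m V (Suc k) f" "i \<in> V" "finite V"
  shows "deg_below m (V - {i}) k (\<lambda>X. f (insert i X))"
  using assms
proof (induction m arbitrary: V k f)
  case 0
  have "insert i X \<in> supp V (Suc k) f" if "X \<in> supp (V - {i}) k (\<lambda>X. f (insert i X))" for X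
  proof -
    have X: "X \<subseteq> V" "card X = k" "i \<notin> X" "f (insert i X) \<noteq> \<one>"
      using that by (auto simp: supp_def)
    then have "finite X" using 0 finite_subset by blast
    then show ?thesis using X 0 by (simp add: supp_def)
  qed
  then show ?case using 0 by auto
next
  case (Suc m)
  show ?case unfolding deg_below.simps
  proof (intro allI impI)
    fix l a b assume *: "k = Suc l" "a \<in> V - {i}" "b \<in> V - {i}" "a \<noteq> b"
    have "deg_below m (V - {a, b} - {i}) l (\<lambda>X. swap_diff a b f (insert i X))"
      using * Suc.prems by (intro Suc.IH) auto
    then show "deg_below m (V - {i} - {a, b}) l (swap_diff a b (\<lambda>X. f (insert i X)))"
      by (simp add: swap_diff_insert Diff_right_commute)
  qed
qed

text \<open>There are no such sets at all, and this persists: a swap removes two elements from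
  \<open>V\<close> but lowers \<open>k\<close> only by one.\<close>

lemma deg_below_card_less:
  "card V < k \<Longrightarrow> finite V \<Longrightarrow> deg_below m V k f"
proof (induction m arbitrary: V k f)
  case 0
  have "card X < k" if "X \<subseteq> V" for X using card_mono[OF 0(2) that] 0(1) by simp
  then show ?case by (auto simp: supp_def)
next
  case (Suc m V k f)
  show ?case unfolding deg_below.simps
  proof (intro allI impI)
    fix l a b assume *: "k = Suc l" "a \<in> V" "b \<in> V" "a \<noteq> b"
    have "card (V - {a, b}) = card V - 2" using * Suc.prems by (subst card_Diff_subset) auto
    moreover have "card {a, b} \<le> card V" using * Suc.prems by (intro card_mono) auto
    ultimately show "deg_below m (V - {a, b}) l (swap_diff a b f)"
      using * Suc.prems by (intro Suc.IH) auto
  qed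
qed

text \<open>Complementation turns the swap difference for \<open>a\<close>, \<open>b\<close> into
  the one for \<open>b\<close>, \<open>a\<close>.\<close>

lemma deg_below_compl:
  assumes "deg_below m V k f" "finite V" "k + k' = card V"
  shows "deg_below m V k' (\<lambda>X. f (V - X))"
  using assms
proof (induction m arbitrary: V k k' f)
  case 0
  have "V - X \<in> supp V k f" if "X \<in> supp V k' (\<lambda>X. f (V - X))" for X
    using that 0 by (auto simp: supp_def card_Diff_subset finite_subset)
  then show ?case using 0 by auto
next
  case (Suc m)
  show ?case unfolding deg_below.simps
  proof (intro allI impI)
    fix l a b assume *: "k' = Suc l" "a \<in> V" "b \<in> V" "a \<noteq> b"
    let ?W = "V - {a, b}"
    have c: "card ?W = card V - 2" using Suc.prems * by (subst card_Diff_subset) auto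
    have c2: "card V \<ge> 2" using * Suc.prems card_mono[of V "{a,b}"] by auto
    show "deg_below m ?W l (swap_diff a b (\<lambda>X. f (V - X)))"
    proof (cases k)
      \<comment> \<open>Now \<open>k'\<close> is the size of \<open>V\<close>, so after a swap the
        required sets are larger than the ground set.\<close>
      case 0
      then show ?thesis using * Suc.prems c c2 by (intro deg_below_card_less) auto
    next
      case (Suc j)
      have "deg_below m ?W l (\<lambda>X. swap_diff b a f (?W - X))"
      proof (rule Suc.IH)
        show "deg_below m ?W j (swap_diff b a f)"
          using deg_belowD[of m V j f b a] Suc.prems(1) * Suc by (simp add: insert_commute)
      qed (use Suc.prems * c c2 Suc in auto)
      moreover have "swap_diff b a f (?W - X) = swap_diff a b (\<lambda>X. f (V - X)) X" if "X \<subseteq> ?W" for X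
      proof -
        have "insert a (?W - X) = V - insert b X" "insert b (?W - X) = V - insert a X"
          using that * by auto
        then show ?thesis by (simp add: swap_diff_def)
      qed
      ultimately show ?thesis
        using deg_below_cong[of ?W l "\<lambda>X. swap_diff b a f (?W - X)"] Suc.prems by auto
    qed
  qed
qed

section \<open>Polynomials have bounded degree in the sense of swaps\<close>

lemma deg_below_one: "deg_below m V k (\<lambda>X. \<one>)"
  by (induction m arbitrary: V k) (auto simp: supp_def swap_diff_def[abs_def])

lemma deg_below_mult:
  assumes "deg_below m V k f" "deg_below m V k g" "\<And>X. f X \<in> carrier G" "\<And>X. g X \<in> carrier G"
  shows "deg_below m V k (\<lambda>X. f X \<otimes> g X)"
  using assms
proof (induction m arbitrary: V k f g)
  case 0
  then show ?case by (auto simp: supp_def)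
next
  case (Suc m)
  show ?case unfolding deg_below.simps
  proof (intro allI impI)
    fix l a b assume *: "k = Suc l" "a \<in> V" "b \<in> V" "a \<noteq> b"
    have "deg_below m (V - {a, b}) l (\<lambda>X. swap_diff a b f X \<otimes> swap_diff a b g X)"
      using * Suc.prems by (intro Suc.IH) auto
    moreover have "swap_diff a b (\<lambda>X. f X \<otimes> g X) = (\<lambda>X. swap_diff a b f X \<otimes> swap_diff a b g X)"
      using Suc.prems by (auto simp: swap_diff_def fun_eq_iff inv_mult m_ac)
    ultimately show "deg_below m (V - {a, b}) l (swap_diff a b (\<lambda>X. f X \<otimes> g X))" by simp
  qed
qed

text \<open>A swap difference of the monomial of \<open>S\<close> vanishes if \<open>S\<close>
  contains both or neither of \<open>a\<close>, \<open>b\<close>; otherwise it is, up to inversion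
  of the coefficient, the monomial with the one swapped element removed.\<close>

lemma deg_below_monomial:
  assumes "finite S" "card S < m" "c \<in> carrier G" "finite V"
  shows "deg_below m V k (\<lambda>X. if S \<subseteq> X then c else \<one>)"
  using assms
proof (induction m arbitrary: V k S c)
  case 0
  then show ?case by simp
next
  case (Suc m)
  show ?case unfolding deg_below.simps
  proof (intro allI impI)
    fix l a b assume *: "k = Suc l" "a \<in> V" "b \<in> V" "a \<noteq> b"
    let ?f = "\<lambda>X. if S \<subseteq> X then c else \<one>" and ?W = "V - {a, b}"
    have cong: "deg_below m ?W l (swap_diff a b ?f) = deg_below m ?W l g"
      if "\<And>X. a \<notin> X \<Longrightarrow> b \<notin> X \<Longrightarrow> swap_diff a b ?f X = g X" for g
      using that Suc.prems(4) by (intro deg_below_cong) auto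
    show "deg_below m ?W l (swap_diff a b ?f)"
    proof (cases "a \<in> S \<longleftrightarrow> b \<in> S")
      case True
      have "swap_diff a b ?f X = \<one>" if "a \<notin> X" "b \<notin> X" for X
        using True that * Suc.prems by (auto simp: swap_diff_def)
      then show ?thesis using cong[of "\<lambda>X. \<one>"] deg_below_one by simp
    next
      case False
      define s where "s = (if a \<in> S then a else b)"
      define c' where "c' = (if a \<in> S then c else inv c)"
      have "swap_diff a b ?f X = (if S - {s} \<subseteq> X then c' else \<one>)" if "a \<notin> X" "b \<notin> X" for X
        using False that * Suc.prems by (auto simp: swap_diff_def s_def c'_def)
      moreover have "deg_below m ?W l (\<lambda>X. if S - {s} \<subseteq> X then c' else \<one>)"
      proof (rule Suc.IH)
        have "s \<in> S" using False by (auto simp: s_def)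
        then show "card (S - {s}) < m" using Suc.prems(1,2)
          by (metis Suc_less_SucD card.remove)
      qed (use Suc.prems in \<open>auto simp: c'_def\<close>)
      ultimately show ?thesis using cong by simp
    qed
  qed
qed

lemma deg_below_polynomial:
  assumes "finite F" "\<And>S. S \<in> F \<Longrightarrow> finite S \<and> card S < m" "a \<in> F \<rightarrow> carrier G" "finite V"
  shows "deg_below m V k (\<lambda>X. finprod G a {S \<in> F. S \<subseteq> X})"
  using assms
proof (induction F rule: finite_induct)
  case empty
  then show ?case by (simp add: deg_below_one)
next
  case (insert S F)
  have "finprod G a {T \<in> insert S F. T \<subseteq> X} =
      (if S \<subseteq> X then a S else \<one>) \<otimes> finprod G a {T \<in> F. T \<subseteq> X}" for X
  proof (cases "S \<subseteq> X")
    case True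
    then have "{T \<in> insert S F. T \<subseteq> X} = insert S {T \<in> F. T \<subseteq> X}" by auto
    then show ?thesis using insert True by (subst \<open>{T \<in> insert S F. T \<subseteq> X} = _\<close>, subst finprod_insert) auto
  next
    case False
    then have "{T \<in> insert S F. T \<subseteq> X} = {T \<in> F. T \<subseteq> X}" by auto
    moreover have "finprod G a {T \<in> F. T \<subseteq> X} \<in> carrier G" using insert.prems by (intro finprod_closed) auto
    ultimately show ?thesis using False by simp
  qed
  moreover have "deg_below m V k (\<lambda>X. (if S \<subseteq> X then a S else \<one>) \<otimes> finprod G a {T \<in> F. T \<subseteq> X})"
    using insert.prems insert.IH by (intro deg_below_mult deg_below_monomial) (auto intro!: finprod_closed)
  ultimately show ?case by simp
qed

text \<open>Such an \<open>f\<close> is \<open>x\<^sub>i\<close> times a function of degree one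
  less. After \<open>m\<close> swaps avoiding \<open>i\<close>, swap \<open>i\<close> against some
  \<open>j\<close> outside the set: the term with \<open>j\<close> vanishes, hence so does the one
  with \<open>i\<close>. The size condition provides this \<open>j\<close>; each swap lowers both of
  its sides by two.\<close>

lemma deg_below_supported_on_element:
  assumes "deg_below (Suc m) V (Suc k) f" "i \<in> V" "finite V" "\<And>X. f X \<in> carrier G"
    and "\<And>X. X \<subseteq> V - {i} \<Longrightarrow> card X = Suc k \<Longrightarrow> f X = \<one>" "Suc k + m < card V"
  shows "deg_below m (V - {i}) k (\<lambda>X. f (insert i X))"
  using assms
proof (induction m arbitrary: V k f)
  case 0
  have "f (insert i X) = \<one>" if X: "X \<subseteq> V - {i}" "card X = k" for X
  proof -
    have fX: "finite X" using X 0 finite_subset by blast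
    have "card (insert i X) < card V" using X fX 0 by (auto simp: card_insert_if)
    then have "\<not> V \<subseteq> insert i X" using card_mono[of "insert i X" V] fX by auto
    then obtain j where j: "j \<in> V" "j \<notin> insert i X" by auto
    have "deg_below 0 (V - {i, j}) k (swap_diff i j f)" using 0 j by auto
    then have "swap_diff i j f X = \<one>" using X j by (auto simp: supp_def)
    moreover have "f (insert j X) = \<one>" using 0 X j fX by auto
    ultimately show ?thesis using swap_diff_eq_one_iff[of f] 0 by metis
  qed
  then show ?case by (auto simp: supp_def)
next
  case (Suc m)
  show ?case unfolding deg_below.simps(2)[of m]
  proof (intro allI impI)
    fix l a b assume *: "k = Suc l" "a \<in> V - {i}" "b \<in> V - {i}" "a \<noteq> b"
    have c: "card (V - {a, b}) = card V - 2" using Suc.prems * by (subst card_Diff_subset) auto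
    have "deg_below m (V - {a, b} - {i}) l (\<lambda>X. swap_diff a b f (insert i X))"
    proof (rule Suc.IH)
      show "deg_below (Suc m) (V - {a, b}) (Suc l) (swap_diff a b f)"
        using Suc.prems(1) * unfolding deg_below.simps(2)[of "Suc m"] by auto
      fix X assume X: "X \<subseteq> V - {a, b} - {i}" "card X = Suc l"
      then have "finite X" using Suc.prems(3) finite_subset by blast
      then have "f (insert a X) = \<one>" "f (insert b X) = \<one>"
        using X * by (intro Suc.prems(5); auto simp: card_insert_if)+
      then show "swap_diff a b f X = \<one>" by (simp add: swap_diff_def)
    qed (use Suc.prems * c in auto)
    then show "deg_below m (V - {i} - {a, b}) l (swap_diff a b (\<lambda>X. f (insert i X)))"
      by (simp add: swap_diff_insert Diff_right_commute)
  qed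
qed

text \<open>If \<open>m\<close> elements of \<open>J\<close> could be swapped against elements of \<open>X\<close>, only \<open>X\<close> would contribute to the
  \<open>m\<close>-fold difference.\<close>

lemma deg_below_avoided_card:
  assumes "deg_below m V k f" "X \<in> supp V k f" "J \<subseteq> V" "finite V" "\<And>X. f X \<in> carrier G"
    and "\<And>Y. Y \<subseteq> V \<Longrightarrow> card Y = k \<Longrightarrow> Y \<inter> J \<noteq> {} \<Longrightarrow> f Y = \<one>" "m \<le> k"
  shows "card J < m"
  using assms
proof (induction m arbitrary: V k f X J)
  case 0
  then show ?case by auto
next
  case (Suc m)
  show ?case
  proof (rule ccontr)
    assume "\<not> card J < Suc m"
    then obtain j where j: "j \<in> J" by fastforce
    have X: "X \<subseteq> V" "card X = k" "f X \<noteq> \<one>" using Suc.prems(2) by (auto simp: supp_def)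
    obtain l where l: "k = Suc l" using Suc.prems(7) by (cases k) auto
    obtain a where a: "a \<in> X" using X l by fastforce
    have XJ: "X \<inter> J = {}" using Suc.prems(6) X by blast
    have fX: "finite X" using X Suc.prems(4) finite_subset by blast
    have "card (J - {j}) < m"
    proof (rule Suc.IH[of "V - {a, j}" l "swap_diff a j f" "X - {a}"])
      show "deg_below m (V - {a, j}) l (swap_diff a j f)"
        using Suc.prems(1,3) l a j X XJ by (intro deg_belowD) auto
      have "f (insert j (X - {a})) = \<one>"
        using X j a fX l Suc.prems(3) XJ by (intro Suc.prems(6)) (auto simp: card_insert_if)
      then have "swap_diff a j f (X - {a}) = f X"
        using a Suc.prems(5) by (simp add: swap_diff_def insert_absorb)
      then show "X - {a} \<in> supp (V - {a, j}) l (swap_diff a j f)"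
        using X a j l XJ fX by (auto simp: supp_def)
      fix Y assume Y: "Y \<subseteq> V - {a, j}" "card Y = l" "Y \<inter> (J - {j}) \<noteq> {}"
      then have fY: "finite Y" using Suc.prems(4) finite_subset by blast
      have "f (insert a Y) = \<one>" "f (insert j Y) = \<one>"
        using Y fY l a X j Suc.prems(3) by (intro Suc.prems(6); auto simp: card_insert_if)+
      then show "swap_diff a j f Y = \<one>" by (simp add: swap_diff_def)
    qed (use Suc.prems XJ a l in auto)
    moreover have "card J = Suc (card (J - {j}))"
      using j Suc.prems(3,4) finite_subset card.remove by metis
    ultimately show False using \<open>\<not> card J < Suc m\<close> by simp
  qed
qed

text \<open>Walk from \<open>X\<close> to \<open>Y\<close>, exchanging one element of
  \<open>X - Y\<close> for one of \<open>Y - X\<close> at a time.\<close>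

lemma constant_if_swap_invariant:
  assumes "\<And>B a b. \<lbrakk>B \<subseteq> V; card B = k; a \<in> V - B; b \<in> V - B; a \<noteq> b\<rbrakk> \<Longrightarrow> f (insert a B) = f (insert b B)"
    and "finite V" "X \<subseteq> V" "Y \<subseteq> V" "card X = Suc k" "card Y = Suc k"
  shows "f X = f Y"
  using assms(3,5)
proof (induction "card (X - Y)" arbitrary: X)
  case 0
  have "finite X" "finite Y" using 0 assms(2,4) finite_subset by auto
  then have "X \<subseteq> Y" using 0 by auto
  then show ?case using card_subset_eq[of Y X] \<open>finite Y\<close> 0 assms by auto
next
  case (Suc m)
  have fin: "finite X" "finite Y" using Suc.prems assms(2,4) finite_subset by auto
  have "X - Y \<noteq> {}" using Suc.hyps(2) by (metis card.empty nat.distinct(1))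
  then obtain a where a: "a \<in> X" "a \<notin> Y" by blast
  have "\<not> Y \<subseteq> X" using card_subset_eq[of X Y] fin Suc.prems assms a by auto
  then obtain b where b: "b \<in> Y" "b \<notin> X" by auto
  let ?B = "X - {a}"
  have "f X = f (insert a ?B)" using a by (simp add: insert_absorb)
  also have "\<dots> = f (insert b ?B)"
    using a b fin Suc.prems assms(4) by (intro assms(1)) auto
  also have "\<dots> = f Y"
  proof (rule Suc.hyps(1))
    have "insert b ?B - Y = (X - Y) - {a}" using a b by auto
    then show "m = card (insert b ?B - Y)" using Suc.hyps(2) a fin by auto
  qed (use a b fin Suc.prems assms(4) in \<open>auto simp: card_insert_if\<close>)
  finally show ?case .
qed

subsection \<open>Density of the support\<close>

lemma card_supp_split:
  assumes "finite V" "i \<in> V"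
  shows "card (supp V (Suc k) f) =
    card (supp (V - {i}) (Suc k) f) + card (supp (V - {i}) k (\<lambda>X. f (insert i X)))"
proof -
  let ?B = "supp (V - {i}) k (\<lambda>X. f (insert i X))"
  have eq: "supp V (Suc k) f = supp (V - {i}) (Suc k) f \<union> insert i ` ?B"
  proof (intro equalityI subsetI)
    fix X assume X: "X \<in> supp V (Suc k) f"
    then have "finite X" using assms finite_subset by (auto simp: supp_def)
    then have "i \<in> X \<Longrightarrow> X - {i} \<in> ?B" using X by (auto simp: supp_def insert_absorb)
    moreover have "i \<in> X \<Longrightarrow> X = insert i (X - {i})" by auto
    moreover have "i \<notin> X \<Longrightarrow> X \<in> supp (V - {i}) (Suc k) f" using X by (auto simp: supp_def)
    ultimately show "X \<in> supp (V - {i}) (Suc k) f \<union> insert i ` ?B" by blast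
  next
    fix X assume "X \<in> supp (V - {i}) (Suc k) f \<union> insert i ` ?B"
    then show "X \<in> supp V (Suc k) f"
    proof
      assume "X \<in> insert i ` ?B"
      then obtain Y where Y: "Y \<in> ?B" "X = insert i Y" by blast
      then have "finite Y" "i \<notin> Y" using assms finite_subset[of Y V] by (auto simp: supp_def)
      then show ?thesis using Y assms by (auto simp: supp_def)
    qed (auto simp: supp_def)
  qed
  have "inj_on (insert i) ?B" by (rule inj_onI) (auto simp: supp_def insert_ident)
  then have "card (insert i ` ?B) = card ?B" by (rule card_image)
  moreover have "supp (V - {i}) (Suc k) f \<inter> insert i ` ?B = {}" by (auto simp: supp_def)
  ultimately show ?thesis unfolding eq using assms by (subst card_Un_disjoint) auto
qed

text \<open>Double counting of the pairs of a support set \<open>X\<close> and some \<open>j\<close>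
  outside \<open>X\<close>.\<close>

lemma sum_card_supp_remove:
  assumes "finite V"
  shows "(\<Sum>j\<in>V. card (supp (V - {j}) k f)) = (card V - k) * card (supp V k f)"
proof -
  have "supp (V - {j}) k f = {X \<in> supp V k f. j \<notin> X}" for j by (auto simp: supp_def)
  then have "(\<Sum>j\<in>V. card (supp (V - {j}) k f)) = (\<Sum>j\<in>V. card {X \<in> supp V k f. j \<notin> X})" by simp
  also have "\<dots> = (card V - k) * card (supp V k f)"
  proof (rule sum_multicount)
    have "card {j \<in> V. j \<notin> X} = card V - k" if "X \<in> supp V k f" for X
    proof -
      have "{j \<in> V. j \<notin> X} = V - X" by blast
      then show ?thesis using that assms finite_subset[of X V]
        by (auto simp: supp_def card_Diff_subset)
    qed
    then show "\<forall>X\<in>supp V k f. card {j \<in> V. j \<notin> X} = card V - k" by blast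
  qed (use assms in auto)
  finally show ?thesis .
qed

lemma sum_card_supp_insert:
  assumes "finite V"
  shows "(\<Sum>j\<in>V. card (supp (V - {j}) k (\<lambda>X. f (insert j X)))) = Suc k * card (supp V (Suc k) f)"
proof (cases "Suc k \<le> card V")
  case True
  have "(\<Sum>j\<in>V. card (supp V (Suc k) f)) =
      (\<Sum>j\<in>V. card (supp (V - {j}) (Suc k) f)) + (\<Sum>j\<in>V. card (supp (V - {j}) k (\<lambda>X. f (insert j X))))"
    unfolding sum.distrib[symmetric] by (rule sum.cong) (use card_supp_split assms in auto)
  then have "card V * card (supp V (Suc k) f) = (card V - Suc k) * card (supp V (Suc k) f) +
      (\<Sum>j\<in>V. card (supp (V - {j}) k (\<lambda>X. f (insert j X))))"
    using sum_card_supp_remove[OF assms, of "Suc k" f] by simp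
  moreover have "card V * card (supp V (Suc k) f) =
      (card V - Suc k) * card (supp V (Suc k) f) + Suc k * card (supp V (Suc k) f)"
    using True by (metis add_mult_distrib le_add_diff_inverse2)
  ultimately show ?thesis by linarith
next
  case False
  have "card X \<noteq> Suc k" if "X \<subseteq> V" for X using card_mono[OF assms that] False by simp
  then have "supp V (Suc k) f = {}" by (auto simp: supp_def)
  then have "card (supp (V - {j}) k (\<lambda>X. f (insert j X))) = 0" if "j \<in> V" for j
    using card_supp_split[OF assms that, of k f] by simp
  then show ?thesis using \<open>supp V (Suc k) f = {}\<close> by simp
qed

section \<open>Densities after conditioning on one coordinate\<close>

lemma dens_nonneg: "0 \<le> dens V k f"
  by (simp add: dens_def)

text \<open>Total probability: \<open>i\<close> belongs to a uniform subset of size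
  \<open>Suc k\<close> with probability \<open>Suc k / card V\<close>.\<close>

lemma dens_split:
  assumes "finite V" "i \<in> V" "Suc k \<le> card V"
  shows "dens V (Suc k) f = (1 - real (Suc k) / card V) * dens (V - {i}) (Suc k) f +
    real (Suc k) / card V * dens (V - {i}) k (\<lambda>X. f (insert i X))"
proof -
  define n where "n = card V"
  have c: "card (V - {i}) = n - 1" using assms by (simp add: n_def)
  have n: "n > 0" using assms n_def by simp
  define N0 N1 where "N0 = real (card (supp (V - {i}) (Suc k) f))"
    and "N1 = real (card (supp (V - {i}) k (\<lambda>X. f (insert i X))))"
  have pos: "real (n choose Suc k) > 0" "real (n - 1 choose k) > 0"
    using assms n_def by (auto simp: zero_less_binomial_iff)
  have 1: "real n * real (n - 1 choose k) = real (Suc k) * real (n choose Suc k)"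
    using binomial_absorption[of k n] by (metis of_nat_mult)
  have 2: "real n * real (n - 1 choose Suc k) = (real n - real (Suc k)) * real (n choose Suc k)"
    using binomial_absorb_comp[of n "Suc k"] assms n_def by (metis of_nat_mult of_nat_diff)
  have A: "N1 / real (n choose Suc k) = real (Suc k) / real n * (N1 / real (n - 1 choose k))"
    using 1 pos n by (simp add: field_simps del: of_nat_Suc binomial_Suc_Suc)
  have B: "N0 / real (n choose Suc k) = (1 - real (Suc k) / real n) * (N0 / real (n - 1 choose Suc k))"
  proof (cases "Suc k = n")
    \<comment> \<open>Here \<open>n - 1 choose Suc k\<close> is 0 and cannot be cancelled, but the
      support is empty and both sides are 0.\<close>
    case True
    have "card X \<noteq> Suc k" if "X \<subseteq> V - {i}" for X
      using card_mono[of "V - {i}" X] that c assms n True by simp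
    then have "supp (V - {i}) (Suc k) f = {}" by (auto simp: supp_def)
    then show ?thesis by (simp add: N0_def)
  next
    case False
    then have pos2: "real (n - 1 choose Suc k) > 0" using assms n_def by (simp add: zero_less_binomial_iff)
    have "(1 - real (Suc k) / real n) * real (n choose Suc k) = real (n - 1 choose Suc k)"
      using 2 n by (simp add: field_simps del: of_nat_Suc binomial_Suc_Suc)
    then show ?thesis using pos pos2 by (simp add: field_simps del: of_nat_Suc binomial_Suc_Suc)
  qed
  have "dens V (Suc k) f = (N0 + N1) / real (n choose Suc k)"
    unfolding dens_def N0_def N1_def n_def using card_supp_split[OF assms(1,2), of k f] by simp
  then show ?thesis using A B unfolding dens_def c N0_def N1_def n_def
    by (simp add: add_divide_distrib)
qed

text \<open>A uniform \<open>j\<close> followed by a uniform \<open>k\<close>-set avoiding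
  \<open>j\<close> produces a uniform \<open>k\<close>-set. The strict inequality ensures that such
  sets exist.\<close>

lemma sum_dens_remove:
  assumes "finite V" "k < card V"
  shows "(\<Sum>j\<in>V. dens (V - {j}) k f) = card V * dens V k f"
proof -
  let ?n = "card V"
  have pos: "real (?n choose k) > 0" "real (?n - 1 choose k) > 0"
    using assms by (auto simp: zero_less_binomial_iff)
  have 2: "real ?n * real (?n - 1 choose k) = (real ?n - real k) * real (?n choose k)"
    using binomial_absorb_comp[of ?n k] assms by (metis less_imp_le_nat of_nat_mult of_nat_diff)
  have "(\<Sum>j\<in>V. dens (V - {j}) k f) = (\<Sum>j\<in>V. real (card (supp (V - {j}) k f)) / real (?n - 1 choose k))"
    by (rule sum.cong) (use assms in \<open>auto simp: dens_def\<close>)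
  also have "\<dots> = real ((?n - k) * card (supp V k f)) / real (?n - 1 choose k)"
    unfolding sum_divide_distrib[symmetric] of_nat_sum[symmetric]
    by (simp only: sum_card_supp_remove[OF assms(1)])
  also have "\<dots> = (real ?n - real k) * real (card (supp V k f)) / real (?n - 1 choose k)"
    using assms by (simp add: of_nat_diff)
  also have "\<dots> = ?n * dens V k f"
  proof -
    have "N * c / b = a * (N / e)" if "a * b = c * e" "b > 0" "e > 0" for N a b c e :: real
    proof -
      have "c / b = a / e" using that by (simp add: frac_eq_eq mult.commute)
      then show ?thesis by (metis mult.commute times_divide_eq_right)
    qed
    from this[OF 2 pos(2,1), of "card (supp V k f)"] show ?thesis by (simp add: dens_def mult.commute)
  qed
  finally show ?thesis .
qed

text \<open>A uniform \<open>j\<close> joined to a uniform \<open>k\<close>-subset of the remaining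
  elements produces a uniform set of size \<open>Suc k\<close>.\<close>

lemma sum_dens_insert:
  assumes "finite V" "Suc k \<le> card V"
  shows "(\<Sum>j\<in>V. dens (V - {j}) k (\<lambda>X. f (insert j X))) = card V * dens V (Suc k) f"
proof -
  let ?n = "card V"
  have pos: "real (?n choose Suc k) > 0" "real (?n - 1 choose k) > 0"
    using assms by (auto simp: zero_less_binomial_iff)
  have 1: "real ?n * real (?n - 1 choose k) = real (Suc k) * real (?n choose Suc k)"
    using binomial_absorption[of k ?n] by (metis of_nat_mult)
  have "(\<Sum>j\<in>V. dens (V - {j}) k (\<lambda>X. f (insert j X))) =
      (\<Sum>j\<in>V. real (card (supp (V - {j}) k (\<lambda>X. f (insert j X)))) / real (?n - 1 choose k))"
    by (rule sum.cong) (use assms in \<open>auto simp: dens_def\<close>)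
  also have "\<dots> = real (Suc k * card (supp V (Suc k) f)) / real (?n - 1 choose k)"
    unfolding sum_divide_distrib[symmetric] of_nat_sum[symmetric]
    by (simp only: sum_card_supp_insert[OF assms(1)])
  also have "\<dots> = real (Suc k) * real (card (supp V (Suc k) f)) / real (?n - 1 choose k)"
    by (simp only: of_nat_mult)
  also have "\<dots> = ?n * dens V (Suc k) f"
  proof -
    have "c * N / b = a * (N / e)" if "a * b = c * e" "b > 0" "e > 0" for N a b c e :: real
    proof -
      have "c / b = a / e" using that by (simp add: frac_eq_eq mult.commute)
      then show ?thesis by (metis mult.commute times_divide_eq_right)
    qed
    from this[OF 1 pos(2,1)] show ?thesis unfolding dens_def .
  qed
  finally show ?thesis .
qed

text \<open>Where a difference is nonzero, at least one of its two terms is.\<close>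

lemma dens_swap_diff_le:
  assumes "finite W" "\<And>X. f X \<in> carrier G"
  shows "dens W l (swap_diff a b f) \<le> dens W l (\<lambda>X. f (insert a X)) + dens W l (\<lambda>X. f (insert b X))"
proof -
  have "supp W l (swap_diff a b f) \<subseteq> supp W l (\<lambda>X. f (insert a X)) \<union> supp W l (\<lambda>X. f (insert b X))"
    by (auto simp: supp_def swap_diff_def)
  then have "card (supp W l (swap_diff a b f)) \<le>
      card (supp W l (\<lambda>X. f (insert a X))) + card (supp W l (\<lambda>X. f (insert b X)))"
    using assms by (meson card_Un_le card_mono finite_UnI finite_supp le_trans)
  then show ?thesis unfolding dens_def
    by (metis add_divide_distrib divide_right_mono of_nat_0_le_iff of_nat_add of_nat_mono)
qed

text \<open>One sensitive swap of \<open>a\<close> and \<open>b\<close> makes every \<open>j\<close>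
  sensitive to a swap with \<open>a\<close> or with \<open>b\<close>, so one of these two serves at
  least half of all \<open>j\<close>.\<close>

lemma exists_pivot:
  assumes "finite V" "B \<subseteq> V" "card B = l" "a \<in> V - B" "b \<in> V - B" "a \<noteq> b"
    and ne: "f (insert a B) \<noteq> f (insert b B)" and cl: "\<And>X. f X \<in> carrier G"
  obtains i where "i \<in> V"
    "card V \<le> 2 * card {j \<in> V - {i}. supp (V - {i, j}) l (swap_diff i j f) \<noteq> {}}"
proof -
  define J where "J i = {j \<in> V - {i}. supp (V - {i, j}) l (swap_diff i j f) \<noteq> {}}" for i
  have JI: "j \<in> J i" if "j \<in> V" "j \<noteq> i" "X \<subseteq> V - {i, j}" "card X = l" "f (insert i X) \<noteq> f (insert j X)" for i j X
  proof -
    have "X \<in> supp (V - {i, j}) l (swap_diff i j f)"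
      using that swap_diff_eq_one_iff[of f i j X] cl by (simp add: supp_def)
    then show ?thesis using that by (auto simp: J_def)
  qed
  have fB: "finite B" using assms finite_subset by blast
  have "V \<subseteq> J a \<union> J b"
  proof
    fix j assume j: "j \<in> V"
    consider "j = a" | "j = b" | "j \<notin> B" "j \<noteq> a" "j \<noteq> b" | "j \<in> B" by blast
    then show "j \<in> J a \<union> J b"
    proof cases
      case 1
      then show ?thesis using JI[of a b B] assms by auto
    next
      case 2
      then show ?thesis using JI[of b a B] assms by auto
    next
      case 3
      then show ?thesis using JI[of j a B] JI[of j b B] assms j by (cases "f (insert j B) = f (insert a B)") auto
    next
      case 4
      \<comment> \<open>Exchanging \<open>j\<close> for \<open>b\<close> in
        \<open>insert a B\<close>, or for \<open>a\<close> in \<open>insert b B\<close>, leads to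
        the same set. Its value cannot agree with both of the different starting values.\<close>
      let ?Xa = "insert a (B - {j})" and ?Xb = "insert b (B - {j})"
      have "card B > 0" using 4 fB by (auto simp: card_gt_0_iff)
      then have c: "card ?Xa = l" "card ?Xb = l" using 4 fB assms by auto
      have e: "insert j ?Xa = insert a B" "insert j ?Xb = insert b B" "insert b ?Xa = insert a ?Xb"
        using 4 by auto
      then have "f (insert b ?Xa) \<noteq> f (insert j ?Xa) \<or> f (insert a ?Xb) \<noteq> f (insert j ?Xb)"
        using ne by metis
      then show ?thesis using JI[of j b ?Xa] JI[of j a ?Xb] c 4 assms j by auto
    qed
  qed
  then have "card V \<le> card (J a \<union> J b)" using assms by (intro card_mono) (auto simp: J_def)
  also have "\<dots> \<le> card (J a) + card (J b)" by (rule card_Un_le)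
  finally have "card V \<le> 2 * card (J a) \<or> card V \<le> 2 * card (J b)" by linarith
  then show ?thesis using that[of a] that[of b] assms by (auto simp: J_def)
qed

section \<open>Constant functions and functions of degree at most one\<close>

lemma dens_nonvanishing_eq_one:
  assumes "finite V" "k \<le> card V" "\<And>X. X \<subseteq> V \<Longrightarrow> card X = k \<Longrightarrow> f X \<noteq> \<one>"
  shows "dens V k f = 1"
proof -
  have "supp V k f = {X. X \<subseteq> V \<and> card X = k}" using assms(3) by (auto simp: supp_def)
  then show ?thesis using n_subsets[OF assms(1), of k] assms(2) by (simp add: dens_def)
qed

text \<open>Without a sensitive swap the function is constant, hence nonzero everywhere as it is
  nonzero somewhere. For \<open>k = 0\<close> there is only the empty set.\<close>

lemma dens_one_or_swap_sensitive:
  assumes "finite V" "supp V k f \<noteq> {}"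
  obtains (one) "dens V k f = 1"
  | (swap) l B a b where "k = Suc l" "B \<subseteq> V" "card B = l" "a \<in> V - B" "b \<in> V - B" "a \<noteq> b"
      "f (insert a B) \<noteq> f (insert b B)"
proof -
  obtain X where X: "X \<subseteq> V" "card X = k" "f X \<noteq> \<one>" using assms by (auto simp: supp_def)
  have kV: "k \<le> card V" using X assms card_mono by auto
  show thesis
  proof (cases k)
    case 0
    have "X = {}" using X 0 assms(1) finite_subset[of X V] by auto
    have "Y = {}" if "Y \<subseteq> V" "card Y = k" for Y
      using that 0 assms(1) finite_subset[of Y V] by auto
    then have "dens V k f = 1" using X \<open>X = {}\<close> by (intro dens_nonvanishing_eq_one[OF assms(1) kV]) auto
    then show thesis by (rule one)
  next
    case (Suc l)
    show thesis
    proof (cases "\<exists>B a b. B \<subseteq> V \<and> card B = l \<and> a \<in> V - B \<and> b \<in> V - B \<and> a \<noteq> b \<and>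
        f (insert a B) \<noteq> f (insert b B)")
      case True
      then show thesis using swap[OF Suc] by blast
    next
      case False
      have eq: "f Y = f X" if "Y \<subseteq> V" "card Y = k" for Y
      proof (rule constant_if_swap_invariant[of V l])
        show "f (insert a B) = f (insert b B)"
          if "B \<subseteq> V" "card B = l" "a \<in> V - B" "b \<in> V - B" "a \<noteq> b" for B a b
          using False that by blast
      qed (use assms that X Suc in auto)
      have "f Y \<noteq> \<one>" if "Y \<subseteq> V" "card Y = k" for Y
        using eq[OF that] X(3) by simp
      then have "dens V k f = 1" by (rule dens_nonvanishing_eq_one[OF assms(1) kV])
      then show thesis by (rule one)
    qed
  qed
qed

lemma dens_eq_one_if_deg_zero:
  assumes "finite V" "supp V k f \<noteq> {}" "deg_below (Suc 0) V k f" "\<And>X. f X \<in> carrier G"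
  shows "dens V k f = 1"
  using assms(1,2)
proof (cases rule: dens_one_or_swap_sensitive)
  case (swap l B a b)
  then have "deg_below 0 (V - {a, b}) l (swap_diff a b f)" using assms(3) by auto
  then have "swap_diff a b f B = \<one>" using swap by (auto simp: supp_def)
  then show ?thesis using swap swap_diff_eq_one_iff[of f a b B] assms(4) by simp
qed

text \<open>A uniform point \<open>x\<close> of the slice is sampled as follows: with probability \<open>1 - 2k/n\<close> put \<open>x\<^sub>i = 0\<close>;
  otherwise draw \<open>j \<noteq> i\<close> uniformly and put \<open>(x\<^sub>i, x\<^sub>j) = (0, 1)\<close> or \<open>(1, 0)\<close> with equal probability.\<close>

lemma dens_pair_split:
  assumes "finite V" "i \<in> V" "2 * Suc l \<le> card V"
  shows "dens V (Suc l) f = (1 - 2 * (real (Suc l) / card V)) * dens (V - {i}) (Suc l) f +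
    real (Suc l) / card V * ((\<Sum>j\<in>V - {i}. dens (V - {i, j}) l (\<lambda>X. f (insert i X)) +
      dens (V - {i, j}) l (\<lambda>X. f (insert j X))) / real (card V - 1))"
proof -
  let ?W = "V - {i}" and ?p = "real (Suc l) / card V"
  have c: "card ?W = card V - 1" using assms by simp
  have W: "?W - {j} = V - {i, j}" for j by blast
  have 1: "(\<Sum>j\<in>?W. dens (V - {i, j}) l (\<lambda>X. f (insert i X))) = real (card V - 1) * dens ?W l (\<lambda>X. f (insert i X))"
    using sum_dens_remove[of ?W l "\<lambda>X. f (insert i X)"] assms c unfolding W by simp
  have 2: "(\<Sum>j\<in>?W. dens (V - {i, j}) l (\<lambda>X. f (insert j X))) = real (card V - 1) * dens ?W (Suc l) f"
    using sum_dens_insert[of ?W l f] assms c unfolding W by simp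
  have "real (card V - 1) > 0" using assms by auto
  then have M: "(\<Sum>j\<in>?W. dens (V - {i, j}) l (\<lambda>X. f (insert i X)) + dens (V - {i, j}) l (\<lambda>X. f (insert j X)))
      / real (card V - 1) = dens ?W l (\<lambda>X. f (insert i X)) + dens ?W (Suc l) f"
    unfolding sum.distrib 1 2 distrib_left[symmetric] by simp
  have N: "dens V (Suc l) f = (1 - ?p) * dens ?W (Suc l) f + ?p * dens ?W l (\<lambda>X. f (insert i X))"
    using assms by (intro dens_split) auto
  \<comment> \<open>Mass \<open>p\<close> of the branch \<open>x\<^sub>i = 0\<close> moves into the
    pairing, where the average over \<open>j\<close> of the terms with \<open>x\<^sub>j = 1\<close>
    gives back \<open>dens ?W (Suc l) f\<close>.\<close>
  have "(1 - p) * x + p * y = (1 - 2 * p) * x + p * (y + x)" for p x y :: real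
    by (simp add: algebra_simps)
  then show ?thesis unfolding M N .
qed

text \<open>For at least half of the \<open>j\<close> the difference at the pivot is a nonzero
  constant, so the two restrictions have total density at least 1. This covers small
  \<open>k\<close>, where \<open>phi\<close> may be too weak.\<close>

lemma dens_deg_one_ge:
  assumes "finite V" "2 * k \<le> card V" "deg_below 2 V k f" "supp V k f \<noteq> {}" "\<And>X. f X \<in> carrier G"
  shows "(real k / card V) * (1 / 2) \<le> dens V k f"
  using assms(1,4)
proof (cases rule: dens_one_or_swap_sensitive)
  case one
  have "real k / card V \<le> 1" using assms(2) by (simp add: divide_simps)
  then show ?thesis using one by simp
next
  case (swap l B a b)
  let ?n = "card V" and ?p = "real k / card V"
  obtain i where i: "i \<in> V" "?n \<le> 2 * card {j \<in> V - {i}. supp (V - {i, j}) l (swap_diff i j f) \<noteq> {}}"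
    by (rule exists_pivot[of V B l a b f, OF assms(1) swap(2-7) assms(5)])
  define J where "J = {j \<in> V - {i}. supp (V - {i, j}) l (swap_diff i j f) \<noteq> {}}"
  let ?h = "\<lambda>j. dens (V - {i, j}) l (\<lambda>X. f (insert i X)) + dens (V - {i, j}) l (\<lambda>X. f (insert j X))"
  have "1 \<le> ?h j" if "j \<in> J" for j
  proof -
    have "deg_below (Suc 0) (V - {i, j}) l (swap_diff i j f)"
      using assms(3) swap that i by (intro deg_belowD) (auto simp: J_def numeral_2_eq_2)
    then have "dens (V - {i, j}) l (swap_diff i j f) = 1"
      using that assms by (intro dens_eq_one_if_deg_zero) (auto simp: J_def)
    then show ?thesis using dens_swap_diff_le[of "V - {i, j}" f l i j] assms by simp
  qed
  then have "real (card J) \<le> sum ?h J" using sum_mono[of J "\<lambda>_. 1" ?h] by simp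
  also have "\<dots> \<le> sum ?h (V - {i})"
    using assms by (intro sum_mono2) (auto simp: J_def dens_nonneg)
  finally have h: "real (card J) \<le> sum ?h (V - {i})" .
  have n: "real (?n - 1) > 0" "real ?n \<ge> 2" using assms(2) swap by auto
  have "1 / 2 * real (?n - 1) \<le> real (card J)" using i(2) unfolding J_def[symmetric] by linarith
  then have "1 / 2 \<le> sum ?h (V - {i}) / real (?n - 1)" using h n by (simp add: pos_le_divide_eq)
  then have avg: "?p * (1 / 2) \<le> ?p * (sum ?h (V - {i}) / real (?n - 1))"
    by (intro mult_left_mono) auto
  have nn: "0 \<le> (1 - 2 * ?p) * dens (V - {i}) k f"
    using assms(2) n by (intro mult_nonneg_nonneg dens_nonneg) (simp add: divide_simps)
  have split: "dens V k f = (1 - 2 * ?p) * dens (V - {i}) k f + ?p * (sum ?h (V - {i}) / real (?n - 1))"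
    using dens_pair_split[OF assms(1) i(1), of l f] assms(2) swap by simp
  show ?thesis unfolding split by (rule add_increasing[OF nn avg])
qed

text \<open>Every set meeting the set of these \<open>j\<close> has value \<open>\<one>\<close>, so
  \<open>deg_below_avoided_card\<close> applies. This bounds the number of exceptional
  \<open>j\<close> in the pairing step.\<close>

lemma card_vanishing_insertions_less:
  assumes "finite W" "deg_below m W (Suc l) f" "supp W (Suc l) f \<noteq> {}" "m \<le> Suc l"
    "\<And>X. f X \<in> carrier G"
  shows "card {j \<in> W. supp (W - {j}) l (\<lambda>X. f (insert j X)) = {}} < m"
proof -
  let ?J = "{j \<in> W. supp (W - {j}) l (\<lambda>X. f (insert j X)) = {}}"
  obtain X where X: "X \<in> supp W (Suc l) f" using assms by auto
  show ?thesis
  proof (rule deg_below_avoided_card[OF assms(2) X])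
    fix Y assume Y: "Y \<subseteq> W" "card Y = Suc l" "Y \<inter> ?J \<noteq> {}"
    then obtain j where j: "j \<in> Y" "j \<in> W" "supp (W - {j}) l (\<lambda>X. f (insert j X)) = {}" by auto
    have "finite Y" using Y assms finite_subset by blast
    then have "Y - {j} \<subseteq> W - {j}" "card (Y - {j}) = l" using Y j by auto
    then have "f (insert j (Y - {j})) = \<one>" using j(3) by (auto simp: supp_def)
    then show "f Y = \<one>" using j by (simp add: insert_absorb)
  qed (use assms in auto)
qed

section \<open>The lower bound by induction on the size of the ground set\<close>

theorem dens_ge_phi:
  assumes "finite V" "2 * k \<le> card V" "deg_below (Suc d) V k f" "supp V k f \<noteq> {}" "\<And>X. f X \<in> carrier G"
  shows "phi (card V) k d \<le> dens V k f"
  using assms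
proof (induction "card V" arbitrary: V k d f rule: less_induct)
  case less
  let ?n = "card V"
  note fin = less.prems(1) and cl = less.prems(5)
  from fin less.prems(4) show ?case
  proof (cases rule: dens_one_or_swap_sensitive)
    case one
    then show ?thesis using phi_le_one[of k ?n d] less.prems(2) by simp
  next
    case (swap l B a b)
    have "d \<noteq> 0"
    proof
      assume "d = 0"
      then have "deg_below 0 (V - {a, b}) l (swap_diff a b f)" using less.prems(3) swap by auto
      then have "swap_diff a b f B = \<one>" using swap by (auto simp: supp_def)
      then show False using swap swap_diff_eq_one_iff[of f a b B] cl by simp
    qed
    then obtain e where e: "d = Suc e" by (cases d) auto
    show ?thesis
    proof (cases "8 * d\<^sup>2 < k")
      case False
      then have "real k \<le> real (8 * d\<^sup>2)" by (simp only: of_nat_le_iff not_less)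
      then have "real k \<le> 8 * (real d)\<^sup>2" by simp
      then have "1 - 8 * (real d)\<^sup>2 / real k \<le> 0" using swap by (simp add: field_simps)
      then have "phi ?n k d \<le> 0" unfolding phi_def by (intro mult_nonneg_nonpos) auto
      then show ?thesis using dens_nonneg[of V k f] by linarith
    next
      case big: True
      have "d \<le> d\<^sup>2" by (simp add: power2_eq_square)
      then have dk: "d < k" using big by linarith
      have sz: "8 * (Suc e)\<^sup>2 < Suc l" "2 * Suc l \<le> ?n" using big swap e less.prems(2) by auto
      obtain i where i: "i \<in> V" "?n \<le> 2 * card {j \<in> V - {i}. supp (V - {i, j}) l (swap_diff i j f) \<noteq> {}}"
        by (rule exists_pivot[of V B l a b f, OF fin swap(2-7) cl])
      define W where "W = V - {i}"
      have W: "finite W" "card W = ?n - 1" using fin i by (auto simp: W_def)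
      have WV: "W - {j} = V - {i, j}" for j by (auto simp: W_def)
      have n2: "card (V - {i, j}) = ?n - 2" if "j \<in> W" for j
        using that i fin by (subst card_Diff_subset) (auto simp: W_def)
      have deg_i: "deg_below (Suc d) W l (\<lambda>X. f (insert i X))"
        using deg_below_insert[of "Suc d" V l f i] less.prems swap i by (auto simp: W_def simp del: deg_below.simps)
      show ?thesis
      proof (cases "supp W (Suc l) f = {}")
        case True
        have "dens V k f = real (Suc l) / ?n * dens W l (\<lambda>X. f (insert i X))"
          using dens_split[OF fin i(1), of l f] True sz swap(1) by (simp add: dens_def W_def)
        moreover have "phi (card W) l e \<le> dens W l (\<lambda>X. f (insert i X))"
        proof (rule less.hyps)
          show "deg_below (Suc e) W l (\<lambda>X. f (insert i X))"
            unfolding W_def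
          \<comment> \<open>The size condition reads k + d < n here and follows from d < k and
            \<open>2 * k \<le> n\<close>.\<close>
          proof (rule deg_below_supported_on_element)
            show "deg_below (Suc (Suc e)) V (Suc l) f" using less.prems(3) swap(1) e by simp
            show "f X = \<one>" if "X \<subseteq> V - {i}" "card X = Suc l" for X
              using True that by (auto simp: supp_def W_def)
          qed (use i fin cl dk e swap(1) sz in auto)
          have "card (supp V (Suc l) f) \<noteq> 0" using less.prems(4) fin swap(1) by simp
          then show "supp W l (\<lambda>X. f (insert i X)) \<noteq> {}"
            using card_supp_split[OF fin i(1), of l f] True by (auto simp: W_def)
        qed (use W sz cl in auto)
        ultimately show ?thesis
          using phi_factor_step[OF sz] W(2) swap(1) e
          by (smt (verit) divide_nonneg_nonneg mult_left_mono of_nat_0_le_iff)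
      next
        case False
        \<comment> \<open>On \<open>J\<close> the degree drops and the difference is nonzero.
          \<open>Z\<close> holds the exceptional \<open>j\<close>, for which the restriction to
          \<open>x\<^sub>i = 0\<close>, \<open>x\<^sub>j = 1\<close> vanishes; there are at most
          \<open>d\<close> because \<open>f\<close> is nonzero somewhere on
          \<open>x\<^sub>i = 0\<close>.\<close>
        define J where "J = {j \<in> W. supp (V - {i, j}) l (swap_diff i j f) \<noteq> {}}"
        define Z where "Z = {j \<in> W. supp (V - {i, j}) l (\<lambda>X. f (insert j X)) = {}}"
        let ?h = "\<lambda>j. dens (V - {i, j}) l (\<lambda>X. f (insert i X)) + dens (V - {i, j}) l (\<lambda>X. f (insert j X))"
        define u v where "u = phi (?n - 2) l e" and "v = phi (?n - 2) l d"
        have uv: "0 \<le> v" "2 * v \<le> u"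
          using phi_nonneg[OF sz] phi_degree_drop[OF sz] by (simp_all add: u_def v_def e)
        have finJ: "finite J" "finite Z" "J \<subseteq> W" using W by (auto simp: J_def Z_def)
        have degW: "deg_below (Suc d) W (Suc l) f"
          by (rule deg_below_mono[of _ V]) (use less.prems(3) swap(1) W_def in auto)
        have "card Z < Suc d"
          unfolding Z_def WV[symmetric]
          by (rule card_vanishing_insertions_less[OF W(1) degW False]) (use dk swap(1) cl in auto)
        then have cZ: "real (card Z) \<le> real d" by simp
        have cJ: "real (?n - 1) / 2 \<le> real (card J)" using i(2) by (simp add: J_def W_def)
        have J: "u \<le> ?h j" if "j \<in> J" for j
        proof -
          have "phi (card (V - {i, j})) l e \<le> dens (V - {i, j}) l (swap_diff i j f)"
          proof (rule less.hyps)
            show "deg_below (Suc e) (V - {i, j}) l (swap_diff i j f)"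
              using less.prems(3) swap(1) e i that by (intro deg_belowD) (auto simp: J_def W_def)
          qed (use that sz n2[of j] fin cl in \<open>auto simp: J_def\<close>)
          then show ?thesis
            using dens_swap_diff_le[of "V - {i, j}" f l i j] fin cl that n2[of j] by (simp add: u_def J_def)
        qed
        \<comment> \<open>Outside \<open>J\<close> both restrictions agree, and outside
          \<open>Z\<close> they are nonzero, so the bound for degree \<open>d\<close> counts
          twice.\<close>
        have K: "2 * v \<le> ?h j" if "j \<in> W - J - Z" for j
        proof -
          have j: "j \<in> W" "j \<notin> J" "j \<notin> Z" using that by auto
          have "supp (V - {i, j}) l (\<lambda>X. f (insert i X)) = supp (V - {i, j}) l (\<lambda>X. f (insert j X))"
            using j(1,2) swap_diff_eq_one_iff[of f i j] cl by (intro supp_cong) (auto simp: J_def supp_def)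
          moreover from this have "phi (card (V - {i, j})) l d \<le> dens (V - {i, j}) l (\<lambda>X. f (insert i X))"
          proof (intro less.hyps)
            show "deg_below (Suc d) (V - {i, j}) l (\<lambda>X. f (insert i X))"
              using deg_below_mono[OF deg_i, of "V - {i, j}"] by (auto simp: W_def simp del: deg_below.simps)
          qed (use j sz n2[of j] fin cl in \<open>auto simp: Z_def\<close>)
          ultimately show ?thesis using n2[OF j(1)] by (simp add: v_def dens_def)
        qed
        have h1: "real (card J) * u + (real (?n - 1) - real (card J) - real d) * (2 * v) \<le> sum ?h W"
        proof -
          have "real (card J) * u \<le> sum ?h J" using sum_mono[of J "\<lambda>_. u" ?h] J by simp
          moreover have "real (card (W - J - Z)) * (2 * v) \<le> sum ?h (W - J - Z)"
            using sum_mono[of "W - J - Z" "\<lambda>_. 2 * v" ?h] K by simp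
          moreover have "real (?n - 1) - real (card J) - real d \<le> real (card (W - J - Z))"
          proof -
            have "card (W - J) = ?n - 1 - card J" "card J \<le> ?n - 1"
              using finJ W card_mono[of W J] by (auto simp: card_Diff_subset)
            moreover have "card (W - J) - card Z \<le> card (W - J - Z)"
              using finJ(2) by (rule diff_card_le_card_Diff)
            ultimately show ?thesis using cZ by linarith
          qed
          then have "(real (?n - 1) - real (card J) - real d) * (2 * v) \<le> real (card (W - J - Z)) * (2 * v)"
            using uv by (intro mult_right_mono) auto
          moreover have "sum ?h J + sum ?h (W - J - Z) = sum ?h (J \<union> (W - J - Z))"
            using finJ W by (intro sum.union_disjoint[symmetric]) auto
          moreover have "sum ?h (J \<union> (W - J - Z)) \<le> sum ?h W"
            using W finJ by (intro sum_mono2) (auto simp: dens_nonneg)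
          ultimately show ?thesis by linarith
        qed
        \<comment> \<open>Since \<open>2 * v \<le> u\<close>, the bound in \<open>h1\<close>
          increases with the size of \<open>J\<close>, so the worst case is half of all
          \<open>j\<close>.\<close>
        have h2: "real (?n - 1) / 2 * (u - 2 * v) \<le> real (card J) * (u - 2 * v)"
          using cJ uv by (intro mult_right_mono) auto
        have h: "real (?n - 1) / 2 * u + (real (?n - 1) / 2 - real d) * (2 * v) \<le> sum ?h W"
        proof -
          have "N / 2 * u + (N / 2 - D) * (2 * v) =
              (c * u + (N - c - D) * (2 * v)) + (N / 2 * (u - 2 * v) - c * (u - 2 * v))" for N D c
            by (simp add: field_simps)
          from this[of "real (?n - 1)" "real d" "real (card J)"] show ?thesis
            using h1 h2 by linarith
        qed
        have n: "real (?n - 1) > 0" using sz by auto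
        have "u / 2 + v - 2 * real d * v / real (?n - 1) =
            (real (?n - 1) / 2 * u + (real (?n - 1) / 2 - real d) * (2 * v)) / real (?n - 1)"
          using n by (simp add: field_simps del: of_nat_diff)
        also have "\<dots> \<le> sum ?h W / real (?n - 1)" using h n by (intro divide_right_mono) auto
        finally have avg: "u / 2 + v - 2 * real d * v / real (?n - 1) \<le> sum ?h W / real (?n - 1)" .
        let ?p = "real (Suc l) / real ?n"
        have unm: "(1 - 2 * ?p) * phi (?n - 1) (Suc l) d \<le> (1 - 2 * ?p) * dens W (Suc l) f"
        \<comment> \<open>In the balanced case the induction hypothesis does not apply to the branch
          \<open>x\<^sub>i = 0\<close>, but that branch has weight 0.\<close>
        proof (cases "2 * Suc l = ?n")
          case True
          then have "2 * real (Suc l) = real ?n" by linarith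
          then have "1 - 2 * ?p = 0" using n by (simp add: field_simps)
          then show ?thesis by simp
        next
          case ne: False
          have "phi (card W) (Suc l) d \<le> dens W (Suc l) f"
            by (rule less.hyps) (use W sz ne degW False cl in \<open>auto simp del: deg_below.simps\<close>)
          moreover have "0 \<le> 1 - 2 * ?p" using sz n by (simp add: field_simps)
          ultimately show ?thesis using W by (intro mult_left_mono) auto
        qed
        have "phi ?n k d \<le> (1 - 2 * ?p) * phi (?n - 1) (Suc l) d +
            ?p * (u / 2 + v - 2 * real d * v / real (?n - 1))"
          using phi_pair_step[OF sz] by (simp only: u_def v_def e swap(1))
        also have "\<dots> \<le> (1 - 2 * ?p) * dens W (Suc l) f + ?p * (sum ?h W / real (?n - 1))"
          by (intro add_mono unm mult_left_mono avg) auto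
        also have "\<dots> = dens V k f"
          using dens_pair_split[OF fin i(1) sz(2), of f] by (simp only: W_def swap(1))
        finally show ?thesis .
      qed
    qed
  qed
qed

section \<open>Complementation and the choice of the exponent\<close>

lemma supp_compl:
  assumes "finite V" "k + k' = card V"
  shows "supp V k' (\<lambda>X. f (V - X)) = (\<lambda>X. V - X) ` supp V k f"
proof (intro equalityI subsetI)
  fix X assume X: "X \<in> supp V k' (\<lambda>X. f (V - X))"
  then have "V - X \<in> supp V k f" "X = V - (V - X)"
    using assms by (auto simp: supp_def card_Diff_subset finite_subset)
  then show "X \<in> (\<lambda>X. V - X) ` supp V k f" by blast
next
  fix X assume "X \<in> (\<lambda>X. V - X) ` supp V k f"
  then show "X \<in> supp V k' (\<lambda>X. f (V - X))"
    using assms by (auto simp: supp_def card_Diff_subset finite_subset double_diff)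
qed

lemma dens_compl:
  assumes "finite V" "k + k' = card V"
  shows "dens V k' (\<lambda>X. f (V - X)) = dens V k f"
proof -
  have "inj_on (\<lambda>X. V - X) (supp V k f)" by (rule inj_onI) (auto simp: supp_def)
  then have "card (supp V k' (\<lambda>X. f (V - X))) = card (supp V k f)"
    unfolding supp_compl[OF assms] by (rule card_image)
  moreover have "card V choose k' = card V choose k"
    using binomial_symmetric[of k "card V"] assms by (metis diff_add_inverse le_add1)
  ultimately show ?thesis by (simp add: dens_def)
qed

text \<open>With y = k^(1/8) and \<open>d \<le> y\<close> the error 8d^2/k is at most 8/y^6, which
  is below 1/y once \<open>y \<ge> 2\<close>. If y < 2 then \<open>d \<le> 1\<close>, and the factor
  1/2 for degree one exceeds 1 - 1/y.\<close>

lemma dens_bound_lower_half: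
  assumes "finite V" "2 * k \<le> card V" "d \<le> k" "real d \<le> real k powr (1/8)"
    "deg_below (Suc d) V k f" "supp V k f \<noteq> {}" "\<And>X. f X \<in> carrier G"
  shows "(real k / card V) ^ d * (1 - 1 / real k powr (1/8)) \<le> dens V k f"
proof -
  let ?r = "real k / card V"
  define y where "y = real k powr (1/8)"
  have y0: "0 \<le> y" by (simp add: y_def)
  note main = dens_ge_phi[OF assms(1,2,5,6,7)]
  show ?thesis
  proof (cases "d = 0")
    case True
    then have "1 \<le> dens V k f" using main by (simp add: phi_def)
    \<comment> \<open>This includes \<open>k = 0\<close>, where \<open>y = 0\<close> and 1/y is 0 by
      convention, so that the claimed bound is exactly 1.\<close>
    then show ?thesis using True y0 unfolding y_def[symmetric] by simp (smt (verit) divide_nonneg_nonneg)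
  next
    case False
    then have k: "k > 0" using assms(3) by simp
    have d1: "1 \<le> real d" using False by simp
    have yd: "real d \<le> y" using assms(4) y_def by simp
    have k8: "real k = y ^ 8" using k by (simp add: y_def powr_realpow[symmetric] powr_powr)
    show ?thesis
    proof (cases "y < 2")
      case True
      then have "d = 1" using yd d1 by linarith
      moreover have "1 / 2 \<le> 1 / y" using True yd d1 by (intro divide_left_mono) auto
      then have "?r * (1 - 1 / y) \<le> ?r * (1 / 2)" by (intro mult_left_mono) auto
      moreover have "?r * (1 / 2) \<le> dens V k f"
        using \<open>d = 1\<close> assms by (intro dens_deg_one_ge) (auto simp: numeral_2_eq_2 simp del: deg_below.simps)
      ultimately show ?thesis by (simp add: y_def)
    next
      case False
      have "8 * (real d)\<^sup>2 / real k \<le> 8 * y\<^sup>2 / y ^ 8"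
        unfolding k8 using yd d1 by (intro divide_right_mono mult_left_mono power_mono) auto
      also have "\<dots> \<le> 1 / y"
      proof -
        have "2 ^ 3 \<le> y ^ 3" "1 \<le> y ^ 2" using False power_mono[of 2 y 3] by (auto intro!: one_le_power)
        then have "2 ^ 3 * 1 \<le> y ^ 3 * y ^ 2" using y0 by (intro mult_mono) auto
        then have "8 * (y ^ 2 * y) \<le> y ^ 5 * (y ^ 2 * y)"
          using y0 by (intro mult_right_mono) (auto simp: power_add[symmetric])
        then have "8 * y ^ 2 * y \<le> y ^ 8" by (simp add: power_add[symmetric] power_Suc[symmetric] mult.assoc eval_nat_numeral)
        then show ?thesis using False by (simp add: divide_simps)
      qed
      finally have "?r ^ d * (1 - 1 / y) \<le> phi (card V) k d"
        unfolding phi_def by (intro mult_left_mono) auto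
      then show ?thesis using main by (simp add: y_def)
    qed
  qed
qed

lemma dens_bound:
  assumes "finite V" "d \<le> k" "k + d \<le> card V" "t = min k (card V - k)" "real d \<le> real t powr (1/8)"
    "deg_below (Suc d) V k f" "supp V k f \<noteq> {}" "\<And>X. f X \<in> carrier G"
  shows "(real t / card V) ^ d * (1 - 1 / real t powr (1/8)) \<le> dens V k f"
proof (cases "2 * k \<le> card V")
  case True
  then have "t = k" using assms(4) by simp
  show ?thesis
    unfolding \<open>t = k\<close>
    by (rule dens_bound_lower_half[OF assms(1) True assms(2) _ assms(6,7,8)]) (use assms(5) \<open>t = k\<close> in simp)
next
  case False
  let ?f = "\<lambda>X. f (V - X)"
  have t: "t = card V - k" "k + t = card V" using assms(3,4) False by auto
  have "(real t / card V) ^ d * (1 - 1 / real t powr (1/8)) \<le> dens V t ?f"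
  proof (rule dens_bound_lower_half)
    show "deg_below (Suc d) V t ?f" by (rule deg_below_compl[OF assms(6,1) t(2)])
    show "supp V t ?f \<noteq> {}" using supp_compl[OF assms(1) t(2)] assms(7) by simp
  qed (use assms t False in auto)
  then show ?thesis using dens_compl[OF assms(1) t(2)] by simp
qed

end

subsection \<open>Polynomials on slices\<close>

lemma poly_eval_eq:
  "poly_eval G n d P x = finprod G P {S \<in> monomials n d. S \<subseteq> {i. i < n \<and> x i = 1}}"
  unfolding poly_eval_def by (rule arg_cong[of _ _ "finprod G P"]) (auto simp: monomials_def)

lemma bij_betw_slice:
  "bij_betw (\<lambda>x. {i. i < n \<and> x i = 1}) (slice n k) {X. X \<subseteq> {..<n} \<and> card X = k}"
\<comment> \<open>The inverse is the indicator function, restricted because points of the slice are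
  \<open>undefined\<close> outside \<open>{..<n}\<close>.\<close>
proof (rule bij_betwI[where g = "\<lambda>X. \<lambda>i\<in>{..<n}. if i \<in> X then 1 else 0"])
  have val: "x i = (if x i = 1 then 1 else 0)" if "x \<in> {..<n} \<rightarrow>\<^sub>E {0, 1}" "i < n" for x :: "nat \<Rightarrow> nat" and i
    using PiE_mem[OF that(1), of i] that(2) by auto
  show "(\<lambda>x. {i. i < n \<and> x i = 1}) \<in> slice n k \<rightarrow> {X. X \<subseteq> {..<n} \<and> card X = k}"
  proof
    fix x assume x: "x \<in> slice n k"
    then have xE: "x \<in> {..<n} \<rightarrow>\<^sub>E {0, 1}" by (simp add: slice_def)
    have "(\<Sum>i<n. x i) = (\<Sum>i<n. if x i = 1 then 1 else 0)"
    proof (rule sum.cong)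
      fix i assume "i \<in> {..<n}"
      then show "x i = (if x i = 1 then 1 else 0)" by (intro val[OF xE]) simp
    qed simp
    also have "\<dots> = card {i. i < n \<and> x i = 1}"
      by (simp add: sum.If_cases Int_def)
    finally show "{i. i < n \<and> x i = 1} \<in> {X. X \<subseteq> {..<n} \<and> card X = k}" using x by (auto simp: slice_def)
  qed
  show "(\<lambda>X. \<lambda>i\<in>{..<n}. if i \<in> X then 1 else 0) \<in> {X. X \<subseteq> {..<n} \<and> card X = k} \<rightarrow> slice n k"
  proof
    fix X assume X: "X \<in> {X. X \<subseteq> {..<n} \<and> card X = k}"
    then have "{i. i < n \<and> i \<in> X} = X" by auto
    then have "(\<Sum>i<n. if i \<in> X then 1 else 0) = k" using X by (simp add: sum.If_cases Int_def)
    then show "(\<lambda>i\<in>{..<n}. if i \<in> X then 1 else 0) \<in> slice n k" by (auto simp: slice_def)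
  qed
  show "(\<lambda>i\<in>{..<n}. if i \<in> {i. i < n \<and> x i = 1} then 1 else 0) = x" if "x \<in> slice n k" for x
  proof (rule extensionalityI)
    have xE: "x \<in> {..<n} \<rightarrow>\<^sub>E {0, 1}" using that by (simp add: slice_def)
    then show "x \<in> extensional {..<n}" by (simp add: PiE_def)
    fix i assume "i \<in> {..<n}"
    then show "(\<lambda>i\<in>{..<n}. if i \<in> {i. i < n \<and> x i = 1} then 1 else 0) i = x i"
      by (subst val[OF xE, of i]) auto
  qed simp
  show "{i. i < n \<and> (\<lambda>i\<in>{..<n}. if i \<in> X then 1 else 0) i = (1::nat)} = X"
    if "X \<in> {X. X \<subseteq> {..<n} \<and> card X = k}" for X
    using that by (auto split: if_splits)
qed

lemma slice_distance_bound_eighth: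
  fixes G :: "'g monoid" (structure)
  assumes "comm_group G"
  shows "slice_distance_bound (1/8) G"
  unfolding slice_distance_bound_def
proof (intro allI impI ballI)
  interpret comm_group G by fact
  fix d n k t P
  assume t: "t = min k (n - k)" and dk: "d \<le> k" "k + d \<le> n" and dt: "real d \<le> real t powr (1/8)"
    and P: "P \<in> monomials n d \<rightarrow> carrier G" and ex: "\<exists>x\<in>slice n k. poly_eval G n d P x \<noteq> \<one>"
  let ?V = "{..<n}" and ?h = "\<lambda>x::nat \<Rightarrow> nat. {i. i < n \<and> x i = 1}"
  \<comment> \<open>\<open>f\<close> is defined on all sets, so that its values lie in the carrier
    everywhere, as the density bounds demand.\<close>
  define f where "f X = finprod G P {S \<in> monomials n d. S \<subseteq> X}" for X
  note bij = bij_betw_slice[of n k]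
  have ev: "poly_eval G n d P x = f (?h x)" for x by (simp add: poly_eval_eq f_def)
  have cl: "f X \<in> carrier G" for X unfolding f_def using P by (intro finprod_closed) auto
  have fm: "finite (monomials n d)" by (rule finite_subset[of _ "Pow ?V"]) (auto simp: monomials_def)
  have "finite S \<and> card S < Suc d" if "S \<in> monomials n d" for S
    using that finite_subset[of S ?V] by (auto simp: monomials_def)
  then have deg: "deg_below (Suc d) ?V k f"
    unfolding f_def[abs_def] using fm P by (intro deg_below_polynomial) auto
  have supp: "supp ?V k f = ?h ` (slice n k \<inter> {x. poly_eval G n d P x \<noteq> \<one>})"
  proof -
    have "supp ?V k f = {X \<in> ?h ` slice n k. f X \<noteq> \<one>}"
      unfolding bij_betw_imp_surj_on[OF bij] by (auto simp: supp_def)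
    then show ?thesis by (auto simp: ev)
  qed
  have "card (supp ?V k f) = card (slice n k \<inter> {x. poly_eval G n d P x \<noteq> \<one>})"
    unfolding supp by (rule card_image) (rule inj_on_subset[OF bij_betw_imp_inj_on[OF bij]], blast)
  moreover have "card (slice n k) = n choose k"
    using bij_betw_same_card[OF bij] n_subsets[of ?V k] by simp
  moreover have "finite (slice n k)" using bij_betw_finite[OF bij] by simp
  moreover have "slice n k \<noteq> {}" using ex by blast
  ultimately have prob: "measure_pmf.prob (pmf_of_set (slice n k)) {x. poly_eval G n d P x \<noteq> \<one>} = dens ?V k f"
    by (simp add: measure_pmf_of_set dens_def)
  have "supp ?V k f \<noteq> {}" unfolding supp using ex by blast
  then have "(real t / card ?V) ^ d * (1 - 1 / real t powr (1/8)) \<le> dens ?V k f"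
    using t dk dt deg cl by (intro dens_bound) auto
  then show "(real t / real n) ^ d * (1 - 1 / real t powr (1/8)) \<le>
      measure_pmf.prob (pmf_of_set (slice n k)) {x. poly_eval G n d P x \<noteq> \<one>}"
    by (simp add: prob)
qed

subsection \<open>Reduction to countable groups\<close>

text \<open>Every generated element is the product of a finite word over \<open>A\<close> and its
  inverses, and there are countably many words.\<close>

lemma (in group) countable_generate:
  assumes "countable A" "A \<subseteq> carrier G"
  shows "countable (generate G A)"
proof -
  let ?B = "A \<union> m_inv G ` A"
  let ?p = "\<lambda>xs. foldr (\<otimes>) xs \<one>"
  have B: "?B \<subseteq> carrier G" using assms by auto
  have cl: "?p xs \<in> carrier G" if "set xs \<subseteq> ?B" for xs
    using that B by (induction xs) auto
  have app: "?p (xs @ ys) = ?p xs \<otimes> ?p ys" if "set xs \<subseteq> ?B" "set ys \<subseteq> ?B" for xs ys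
    using that(1)
  proof (induction xs)
    case (Cons x xs)
    then show ?case using B cl[of xs] cl[OF that(2)] by (auto simp: m_assoc)
  qed (use cl[OF that(2)] in simp)
  have single: "x \<in> ?p ` lists ?B" if "x \<in> ?B" for x
    using that B by (intro image_eqI[of _ _ "[x]"]) auto
  have "x \<in> ?p ` lists ?B" if "x \<in> generate G A" for x
    using that
  proof (induction rule: generate.induct)
    case one
    then show ?case by (intro image_eqI[of _ _ "[]"]) auto
  next
    case (eng x y)
    then obtain xs ys where "x = ?p xs" "y = ?p ys" "xs \<in> lists ?B" "ys \<in> lists ?B" by blast
    then show ?case
      using app[of xs ys]
      by (intro image_eqI[of _ _ "xs @ ys"]) (auto simp: lists_eq_set simp del: foldr_append)
  qed (intro single; blast)+
  then have "generate G A \<subseteq> ?p ` lists ?B" by blast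
  moreover have "countable (?p ` lists ?B)" using assms(1) by (intro countable_image countable_lists) auto
  ultimately show ?thesis by (rule countable_subset)
qed

text \<open>The group operation is carried over to \<open>nat\<close> along an injective enumeration
  of \<open>S\<close>.\<close>

lemma (in comm_group) transport_countable_subgroup:
  assumes "subgroup S G" "countable S"
  obtains H :: "nat monoid" and e where "comm_group H" "e \<in> S \<rightarrow> carrier H" "inj_on e S" "e \<one> = \<one>\<^bsub>H\<^esub>"
    "\<And>x y. x \<in> S \<Longrightarrow> y \<in> S \<Longrightarrow> e (x \<otimes> y) = e x \<otimes>\<^bsub>H\<^esub> e y"
proof -
  interpret S: subgroup S G by fact
  define e where "e = to_nat_on S"
  define g where "g = inv_into S e"
  have inj: "inj_on e S" unfolding e_def using assms(2) by (rule inj_on_to_nat_on)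
  have ge [simp]: "g (e x) = x" if "x \<in> S" for x using that inj by (simp add: g_def)
  define H :: "nat monoid" where "H = \<lparr>carrier = e ` S, monoid.mult = (\<lambda>a b. e (g a \<otimes> g b)), one = e \<one>\<rparr>"
  have sc: "x \<in> carrier G" if "x \<in> S" for x using that S.subset by blast
  have "comm_group H"
  proof (rule comm_groupI)
    fix x assume "x \<in> carrier H"
    then obtain a where a: "a \<in> S" "x = e a" by (auto simp: H_def)
    then show "\<exists>y\<in>carrier H. y \<otimes>\<^bsub>H\<^esub> x = \<one>\<^bsub>H\<^esub>"
      using sc by (intro bexI[of _ "e (inv a)"]) (auto simp: H_def)
  qed (auto simp: H_def sc m_ac)
  then show thesis
    by (rule that[of H e]) (use inj in \<open>auto simp: H_def\<close>)
qed

lemma (in comm_group) finprod_transport: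
  assumes "subgroup S G" "comm_group H" "e \<in> S \<rightarrow> carrier H" "e \<one> = \<one>\<^bsub>H\<^esub>"
    "\<And>x y. x \<in> S \<Longrightarrow> y \<in> S \<Longrightarrow> e (x \<otimes> y) = e x \<otimes>\<^bsub>H\<^esub> e y" "finite F" "a \<in> F \<rightarrow> S"
  shows "finprod G a F \<in> S \<and> e (finprod G a F) = finprod H (\<lambda>i. e (a i)) F"
  using assms(6,7)
proof (induction F rule: finite_induct)
  case empty
  interpret H: comm_group H by fact
  show ?case using assms(1,4) by (simp add: subgroup.one_closed)
next
  case (insert i F)
  interpret H: comm_group H by fact
  interpret S: subgroup S G by fact
  have "a \<in> F \<rightarrow> carrier G" "a i \<in> carrier G" using insert.prems S.subset by auto
  moreover have "(\<lambda>i. e (a i)) \<in> F \<rightarrow> carrier H" "e (a i) \<in> carrier H" using insert.prems assms(3) by auto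
  ultimately show ?case using insert assms(5) by auto
qed

text \<open>The finitely many coefficients generate a countable subgroup. Its copy over
  \<open>nat\<close> has the same vanishing points, because the transport map is injective and maps
  \<open>\<one>\<close> to the neutral element.\<close>

lemma slice_distance_bound_transfer:
  fixes G :: "'g monoid" (structure)
  assumes "comm_group G" "\<And>H :: nat monoid. comm_group H \<Longrightarrow> slice_distance_bound \<epsilon> H"
  shows "slice_distance_bound \<epsilon> G"
  unfolding slice_distance_bound_def
proof (intro allI impI ballI)
  interpret comm_group G by fact
  fix d n k t P
  assume hyps: "t = min k (n - k)" "d \<le> k" "k + d \<le> n" "real d \<le> real t powr \<epsilon>"
    and P: "P \<in> monomials n d \<rightarrow> carrier G" and ex: "\<exists>x\<in>slice n k. poly_eval G n d P x \<noteq> \<one>"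
  let ?A = "P ` monomials n d"
  have fm: "finite (monomials n d)" by (rule finite_subset[of _ "Pow {..<n}"]) (auto simp: monomials_def)
  have A: "?A \<subseteq> carrier G" using P by auto
  have sub: "subgroup (generate G ?A) G" by (rule generate_is_subgroup[OF A])
  have "countable (generate G ?A)" using fm A by (intro countable_generate) (auto intro: countable_finite)
  from transport_countable_subgroup[OF sub this] obtain H :: "nat monoid" and e where
    H: "comm_group H" "e \<in> generate G ?A \<rightarrow> carrier H" "inj_on e (generate G ?A)" "e \<one> = \<one>\<^bsub>H\<^esub>"
    "\<And>x y. x \<in> generate G ?A \<Longrightarrow> y \<in> generate G ?A \<Longrightarrow> e (x \<otimes> y) = e x \<otimes>\<^bsub>H\<^esub> e y"
    by metis
  define Q where "Q S = e (P S)" for S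
  have Pg: "P \<in> monomials n d \<rightarrow> generate G ?A" by (auto intro: generate.incl)
  have Q: "Q \<in> monomials n d \<rightarrow> carrier H" using Pg H(2) by (auto simp: Q_def)
  have ev: "poly_eval H n d Q x = \<one>\<^bsub>H\<^esub> \<longleftrightarrow> poly_eval G n d P x = \<one>" for x
  proof -
    have "poly_eval G n d P x \<in> generate G ?A \<and> e (poly_eval G n d P x) = poly_eval H n d Q x"
      unfolding poly_eval_def Q_def[abs_def]
      by (rule finprod_transport[OF sub H(1,2,4,5)]) (use fm Pg in auto)
    then show ?thesis using H(3,4) generate.one[of G ?A] by (metis inj_on_eq_iff)
  qed
  show "(real t / real n) ^ d * (1 - 1 / real t powr \<epsilon>) \<le>
      measure_pmf.prob (pmf_of_set (slice n k)) {x. poly_eval G n d P x \<noteq> \<one>}"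
    using assms(2)[OF H(1)] hyps Q ex unfolding slice_distance_bound_def by (simp only: ev[symmetric])
qed

theorem theorem1p1:
  "abs_eps > 0 \<and>
   (\<forall>G :: 'g monoid. comm_group G \<longrightarrow>
     (\<forall>d n k. \<forall>t. t = min k (n - k) \<longrightarrow> d \<le> k \<longrightarrow> k + d \<le> n \<longrightarrow> real d \<le> real t powr abs_eps \<longrightarrow>
       (\<forall>P \<in> monomials n d \<rightarrow> carrier G.
          (\<exists>x\<in>slice n k. poly_eval G n d P x \<noteq> \<one>\<^bsub>G\<^esub>) \<longrightarrow>
          measure_pmf.prob (pmf_of_set (slice n k)) {x. poly_eval G n d P x \<noteq> \<one>\<^bsub>G\<^esub>}
            \<ge> (real t / real n) ^ d * (1 - 1 / real t powr abs_eps))))"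
proof -
  let ?good = "\<lambda>\<epsilon>. \<epsilon> > 0 \<and> (\<forall>G :: nat monoid. comm_group G \<longrightarrow> slice_distance_bound \<epsilon> G)"
  have "?good (1/8)" by (simp add: slice_distance_bound_eighth)
  \<comment> \<open>The choice operator returns some good constant, not necessarily 1/8. Only its
    bound for groups over \<open>nat\<close> is known, so other carrier types need the
    transfer.\<close>
  then have eps: "?good abs_eps" unfolding abs_eps_def by (rule someI)
  have "slice_distance_bound abs_eps G" if "comm_group G" for G :: "'g monoid"
    by (rule slice_distance_bound_transfer[OF that]) (use eps in blast)
  then show ?thesis using eps unfolding slice_distance_bound_def by blast
qed

end
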